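(* Let $n\ge3$. For each $i\in[n]$, the subgroup $Q_i$ of $\mathrm{Aut}(\mathcal{O}_n)$ is contained in $\lambda^{-1}(\mathcal{P}_n^2)$, is isomorphic to $(S_{n-1})^{\times2}$, and the kernel of the restriction to $Q_i$ of the canonical projection, $\pi:Q_i\to\mathrm{Out}(\mathcal{O}_n)$, is trivial. The same holds for $Q_i'$: it is contained in $\lambda^{-1}(\mathcal{P}_n^2)$, is isomorphic to $(S_{n-1})^{\times2}$, and the kernel of $\pi:Q'_i\to\mathrm{Out}(\mathcal{O}_n)$ is trivial. The $2n$ subgroups $\pi(Q_i)$ and $\pi(Q_i')$, $i\in[n]$, are all distinct.
   Context: $[n]=\{1,\dots,n\}$; $S(A)$ is the symmetric group on $A$, $S_n=S([n])$; permutations are composed right to left. The Cuntz algebra $\mathcal{O}_n$ ($n\ge2$) is the universal $C^*$-algebra generated by isometries $S_1,\dots,S_n$ with $\sum_iS_iS_i^*=1$. For a unitary $u\in\mathcal{O}_n$, $\lambda_u$ is the unique unital $*$-endomorphism of $\mathcal{O}_n$ with $\lambda_u(S_i)=uS_i$ for all $i$. A permutation $u\in S([n]^t)$ is identified with the unitary $\sum_{\alpha\in[n]^t}S_{u(\alpha)}S_\alpha^*$, where $S_\alpha=S_{\alpha_1}\cdots S_{\alpha_t}$; $\mathcal{P}_n^t$ is the set of these unitaries, and $\lambda_u$ for a permutation $u$ means $\lambda$ of the corresponding unitary. $\lambda^{-1}(\mathcal{P}_n^2):=\{\lambda_u\in\mathrm{Aut}(\mathcal{O}_n): u\in\mathcal{P}_n^2\}$.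 $\mathrm{Out}(\mathcal{O}_n)$ is the quotient of $\mathrm{Aut}(\mathcal{O}_n)$ by inner automorphisms and $\pi$ is the canonical projection. For $i\in[n]$: $R_i\le S([n]^2)$ is the group of permutations that fix every $(k,j)$ with $k\ne i$ or $j=i$ (so they only permute the points $(i,j)$, $j\neq i$, among themselves). $\check R_i\le S([n]^2)$ is the group of permutations $u$ for which there is $\sigma\in S([n]\setminus\{i\})$ with $u(k,j)=(k,\sigma(j))$ for all $k,j\in[n]\setminus\{i\}$, and $u(k,j)=(k,j)$ if $k=i$ or $j=i$. $C_i$ and $\check C_i$ are defined analogously with the two coordinates of $[n]^2$ exchanged. $Q_i$ is the subgroup of $\mathrm{Aut}(\mathcal{O}_n)$ generated by $\{\lambda_u:u\in R_i\cup\check R_i\}$ and $Q'_i$ the one generated by $\{\lambda_u:u\in C_i\cup\check C_i\}$. *)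

theory Defs
  imports
    "HOL-Analysis.Analysis"
    "HOL-Analysis.Generalised_Binomial_Theorem"
    "HOL-Library.Poly_Mapping"
    "HOL-Algebra.Sym_Groups"
begin

section \<open>Unital C*-algebras\<close>

text \<open>The library has no complex Banach algebras, so the complex scalar multiplication is added on
  top of the real one.  The zero algebra is excluded by the axiom norm 1 = 1 of
  \<^class>\<open>real_normed_algebra_1\<close>.\<close>

class cstar_algebra = banach + real_normed_algebra_1 +
  fixes scaleC :: "complex \<Rightarrow> 'a \<Rightarrow> 'a"  (infixr \<open>*\<^sub>C\<close> 75)
    and star :: "'a \<Rightarrow> 'a"
  assumes scaleC_add_right: "c *\<^sub>C (x + y) = c *\<^sub>C x + c *\<^sub>C y"
    and scaleC_add_left: "(c + d) *\<^sub>C x = c *\<^sub>C x + d *\<^sub>C x"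
    and scaleC_scaleC: "c *\<^sub>C d *\<^sub>C x = (c * d) *\<^sub>C x"
    and scaleC_of_real: "complex_of_real r *\<^sub>C x = r *\<^sub>R x"
    and norm_scaleC: "norm (c *\<^sub>C x) = cmod c * norm x"
    and scaleC_mult_left: "(c *\<^sub>C x) * y = c *\<^sub>C (x * y)"
    and scaleC_mult_right: "x * (c *\<^sub>C y) = c *\<^sub>C (x * y)"
    and star_add: "star (x + y) = star x + star y"
    and star_scaleC: "star (c *\<^sub>C x) = cnj c *\<^sub>C star x"
    and star_mult: "star (x * y) = star y * star x"
    and star_star: "star (star x) = x"
    and cstar_identity: "norm (star x * x) = (norm x)\<^sup>2"

definition unitary :: "'a::cstar_algebra \<Rightarrow> bool" where
  "unitary w \<longleftrightarrow> star w * w = 1 \<and> w * star w = 1"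

text \<open>Unital *-homomorphisms; continuity is automatic, see \<open>unital_star_hom_contractive\<close>.\<close>

definition unital_star_hom :: "('a::cstar_algebra \<Rightarrow> 'b::cstar_algebra) \<Rightarrow> bool" where
  "unital_star_hom \<phi> \<longleftrightarrow>
     (\<forall>x y. \<phi> (x + y) = \<phi> x + \<phi> y) \<and> (\<forall>c x. \<phi> (c *\<^sub>C x) = c *\<^sub>C \<phi> x) \<and>
     (\<forall>x y. \<phi> (x * y) = \<phi> x * \<phi> y) \<and> (\<forall>x. \<phi> (star x) = star (\<phi> x)) \<and> \<phi> 1 = 1"


lemma additive_scaleC_right: "Modules.additive (\<lambda>x. c *\<^sub>C (x::'a::cstar_algebra))"
  by (simp add: Modules.additive_def scaleC_add_right)

lemma scaleC_zero_left [simp]: "0 *\<^sub>C (x::'a::cstar_algebra) = 0"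
  using scaleC_of_real[of 0 x] by simp

lemma scaleC_zero_right [simp]: "c *\<^sub>C (0::'a::cstar_algebra) = 0"
  using Modules.additive.zero[OF additive_scaleC_right] .

lemma scaleC_one [simp]: "1 *\<^sub>C (x::'a::cstar_algebra) = x"
  using scaleC_of_real[of 1 x] by simp

lemma scaleC_sum_right: "c *\<^sub>C (\<Sum>i\<in>I. f i) = (\<Sum>i\<in>I. c *\<^sub>C (f i :: 'a::cstar_algebra))"
  using Modules.additive.sum[OF additive_scaleC_right] .

lemma additive_star: "Modules.additive (star :: 'a::cstar_algebra \<Rightarrow> 'a)"
  by (simp add: Modules.additive_def star_add)

lemma star_zero [simp]: "star (0::'a::cstar_algebra) = 0"
  using Modules.additive.zero[OF additive_star] .

lemma star_sum: "star (\<Sum>i\<in>I. f i) = (\<Sum>i\<in>I. star (f i :: 'a::cstar_algebra))"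
  using Modules.additive.sum[OF additive_star] .

lemma star_one [simp]: "star (1::'a::cstar_algebra) = 1"
  by (metis mult.right_neutral star_mult star_star)

lemma star_scaleR: "star (r *\<^sub>R (x::'a::cstar_algebra)) = r *\<^sub>R star x"
  using star_scaleC[of "complex_of_real r" x] by (simp add: scaleC_of_real)

lemma norm_star [simp]: "norm (star (x::'a::cstar_algebra)) = norm x"
proof -
  have le: "norm y \<le> norm (star y)" for y :: 'a
  proof (cases "norm y = 0")
    case False
    have "(norm y)\<^sup>2 \<le> norm (star y) * norm y"
      using cstar_identity[of y] norm_mult_ineq[of "star y" y] by simp
    with False show ?thesis by (simp add: power2_eq_square)
  qed auto
  from le[of x] le[of "star x"] show ?thesis by (simp add: star_star)
qed

lemma bounded_linear_star: "bounded_linear (star :: 'a::cstar_algebra \<Rightarrow> 'a)"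
  by (rule bounded_linear_intro[where K = 1]) (auto simp: star_add star_scaleR)

lemma bounded_linear_scaleC: "bounded_linear (\<lambda>x. c *\<^sub>C (x::'a::cstar_algebra))"
  by (rule bounded_linear_intro[where K = "cmod c"])
    (auto simp: scaleC_add_right norm_scaleC scaleC_of_real[symmetric] scaleC_scaleC mult.commute)

lemma norm_unitary_le:
  assumes "star c * c = (1::'a::cstar_algebra)" shows "norm c = 1"
  using cstar_identity[of c] assms by (simp add: power2_eq_1_iff) (smt (verit) norm_ge_zero)

lemma selfadjoint_sqrt:
  fixes x :: "'a::cstar_algebra"
  assumes "star x = x" "norm x < 1"
  obtains y where "star y = y" "x * y = y * x" "y * y = 1 - x * x"
proof -
  define t where "t = x * x"
  have "norm t = (norm x)\<^sup>2"
    using cstar_identity[of x] assms(1) by (simp add: t_def)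
  then have t: "norm t < 1" "star t = t" "x * t = t * x"
    using assms by (auto simp: t_def star_mult mult.assoc abs_square_less_1)
  define c where "c k = (-1)^k * ((1/2::real) gchoose k)" for k
  define f where "f k = c k *\<^sub>R t ^ k" for k
  have summ: "summable (\<lambda>k. norm (f k))"
  proof (rule summable_comparison_test)
    have "ereal (norm t) < 1" using t(1) by simp
    also have "1 \<le> conv_radius (\<lambda>k. (1/2::real) gchoose k)"
      by (subst conv_radius_gchoose) auto
    finally show "summable (\<lambda>k. norm (((1/2::real) gchoose k) * (norm t) ^ k))"
      using abs_summable_in_conv_radius[of "norm t" "\<lambda>k. (1/2::real) gchoose k"] by simp
    show "\<exists>N. \<forall>k\<ge>N. norm (norm (f k)) \<le> norm (((1/2::real) gchoose k) * (norm t) ^ k)"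
      by (auto simp: f_def c_def abs_mult norm_power_ineq intro!: exI[of _ 0] mult_left_mono)
  qed
  define y where "y = (suminf (\<lambda>k. f k))"
  have sf: "summable f" using summ by (rule summable_norm_cancel)
  have "star y = (suminf (\<lambda>k. star (f k)))"
    unfolding y_def using bounded_linear.suminf[OF bounded_linear_star sf] by simp
  moreover have "star (t ^ k) = t ^ k" for k
    by (induction k) (simp_all add: star_mult t(2) power_commutes)
  then have "star (f k) = f k" for k by (simp add: f_def star_scaleR)
  ultimately have 1: "star y = y" by (simp add: y_def)
  have "x * t ^ k = t ^ k * x" for k
  proof (induction k)
    case (Suc k)
    have "x * t ^ Suc k = (x * t) * t ^ k" by (simp add: mult.assoc)
    also have "\<dots> = t * (x * t ^ k)" unfolding t(3) by (simp add: mult.assoc)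
    finally show ?case by (simp add: Suc mult.assoc)
  qed simp
  then have "x * f k = f k * x" for k by (simp add: f_def)
  then have 2: "x * y = y * x"
    unfolding y_def using suminf_mult[OF sf, of x] suminf_mult2[OF sf, of x] by simp
  have coef: "(\<Sum>i\<le>k. f i * f (k - i)) = ((-1)^k * ((1::real) gchoose k)) *\<^sub>R t ^ k" for k
  proof -
    have "(\<Sum>i\<le>k. f i * f (k - i)) = (\<Sum>i\<le>k. (c i * c (k - i)) *\<^sub>R t ^ k)"
      by (intro sum.cong) (simp_all add: f_def flip: power_add)
    also have "\<dots> = (\<Sum>i\<le>k. ((-1)^k * (((1/2) gchoose i) * ((1/2) gchoose (k - i)))) *\<^sub>R t ^ k)"
    proof (intro sum.cong refl arg_cong2[where f = scaleR])
      fix i assume "i \<in> {..k}"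
      then have "(-1::real) ^ k = (-1) ^ i * (-1) ^ (k - i)" by (simp flip: power_add)
      then show "c i * c (k - i) = (-1)^k * (((1/2) gchoose i) * ((1/2) gchoose (k - i)))"
        unfolding c_def by (simp only: mult_ac)
    qed
    also have "\<dots> = ((-1)^k * (\<Sum>i\<le>k. ((1/2) gchoose i) * ((1/2) gchoose (k - i)))) *\<^sub>R t ^ k"
      by (simp add: scaleR_sum_left sum_distrib_left)
    also have "(\<Sum>i\<le>k. ((1/2::real) gchoose i) * ((1/2) gchoose (k - i))) = (1 gchoose k)"
      using gbinomial_Vandermonde[of "1/2::real" "1/2" k] by (simp add: atMost_atLeast0)
    finally show ?thesis .
  qed
  have "y * y = (suminf (\<lambda>k. ((-1)^k * ((1::real) gchoose k)) *\<^sub>R t ^ k))"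
    unfolding y_def Cauchy_product[OF summ summ] coef ..
  also have "(suminf (\<lambda>k. ((-1)^k * ((1::real) gchoose k)) *\<^sub>R t ^ k))
      = (\<Sum>k\<in>{0,1}. ((-1)^k * ((1::real) gchoose k)) *\<^sub>R t ^ k)"
  proof (rule suminf_finite)
    fix k :: nat assume "k \<notin> {0, 1}"
    then have "1 < k" by auto
    then have "(1 choose k) = (0::nat)" by simp
    moreover have "(1::real) gchoose k = real (1 choose k)"
      by (metis binomial_gbinomial of_nat_1)
    ultimately show "((-1)^k * ((1::real) gchoose k)) *\<^sub>R t ^ k = 0" by simp
  qed simp
  also have "\<dots> = 1 - t" by simp
  finally show ?thesis using 1 2 that t_def by auto
qed

lemma unital_star_homD:
  assumes "unital_star_hom \<phi>"
  shows "\<phi> (x + y) = \<phi> x + \<phi> y" "\<phi> (c *\<^sub>C x) = c *\<^sub>C \<phi> x" "\<phi> (x * y) = \<phi> x * \<phi> y"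
    "\<phi> (star x) = star (\<phi> x)" "\<phi> 1 = 1"
  using assms unfolding unital_star_hom_def by auto

lemma unital_star_hom_linear:
  assumes "unital_star_hom \<phi>" shows "linear \<phi>"
  using unital_star_homD[OF assms]
  by (auto intro!: linearI simp: scaleC_of_real[symmetric])

lemma unital_star_hom_contractive:
  fixes \<phi> :: "'a::cstar_algebra \<Rightarrow> 'b::cstar_algebra"
  assumes \<phi>: "unital_star_hom \<phi>"
  shows "norm (\<phi> x) \<le> norm x"
proof -
  note h = unital_star_homD[OF \<phi>]
  interpret linear \<phi> by (rule unital_star_hom_linear[OF \<phi>])
  have *: "norm (\<phi> x) \<le> 1" if sa: "star x = x" and n: "norm x < 1" for x
  proof -
    obtain y where y: "star y = y" "x * y = y * x" "y * y = 1 - x * x"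
      using selfadjoint_sqrt[OF sa n] .
    define a b where "a = \<phi> x" and "b = \<phi> y"
    have ab: "star a = a" "star b = b" "a * b = b * a" "b * b = 1 - a * a"
      using sa y h(3)[of x y] h(3)[of y x] h(3)[of x x] h(3)[of y y] h(4)[of x] h(4)[of y]
      unfolding a_def b_def by (simp_all add: h(5) diff)
    define u where "u = a + \<i> *\<^sub>C b"
    have su: "star u = a + (-\<i>) *\<^sub>C b" by (simp add: u_def star_add star_scaleC ab)
    have m: "(-\<i>) *\<^sub>C z + \<i> *\<^sub>C z = 0" for z :: 'b
      by (simp add: scaleC_add_left[symmetric])
    have "star u * u = (a * a + b * b) + ((-\<i>) *\<^sub>C (a * b) + \<i> *\<^sub>C (a * b))"
      unfolding su unfolding u_def
      by (simp add: algebra_simps scaleC_mult_left scaleC_mult_right scaleC_scaleC scaleC_add_right ab(3))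
    then have "norm u = 1" by (intro norm_unitary_le) (simp add: m ab)
    moreover have "2 *\<^sub>R a = u + star u"
      unfolding su unfolding u_def using m[of b] by (simp add: algebra_simps scaleR_2)
    ultimately have "norm (2 *\<^sub>R a) \<le> 2"
      by (metis norm_triangle_ineq norm_star one_add_one)
    then show ?thesis by (simp add: a_def)
  qed
  have sa: "norm (\<phi> x) \<le> norm x" if "star x = x" for x
  proof (rule dense_ge)
    fix r assume r: "norm x < r"
    then have r0: "0 < r" by (meson norm_ge_zero le_less_trans)
    have "norm (\<phi> ((1 / r) *\<^sub>R x)) \<le> 1"
      using r r0 that by (intro *) (auto simp: star_scaleR)
    then show "norm (\<phi> x) \<le> r" using r0 by (simp add: scale field_simps)
  qed
  have "(norm (\<phi> x))\<^sup>2 = norm (\<phi> (star x * x))"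
    by (simp add: h cstar_identity)
  also have "\<dots> \<le> norm (star x * x)"
    by (rule sa) (simp add: star_mult star_star)
  also have "\<dots> = (norm x)\<^sup>2" by (rule cstar_identity)
  finally show ?thesis by (rule power2_le_imp_le) simp
qed


section \<open>The free unital *-algebra on a set of generators\<close>

datatype 'i letter = Gen 'i | Gen_star 'i

text \<open>Words form the free monoid, written additively (and noncommutatively) so that
  \<^typ>\<open>'k \<Rightarrow>\<^sub>0 complex\<close> with words as keys carries the monoid algebra multiplication.\<close>

datatype 'i star_word = Word (letters: "'i letter list")

instantiation star_word :: (type) monoid_add
begin
definition zero_star_word :: "'a star_word" where "0 = Word []"
definition plus_star_word :: "'a star_word \<Rightarrow> 'a star_word \<Rightarrow> 'a star_word" where
  "v + w = Word (letters v @ letters w)"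
instance by standard (auto simp: zero_star_word_def plus_star_word_def)
end

type_synonym 'i free_star_algebra = "'i star_word \<Rightarrow>\<^sub>0 complex"

definition fgen :: "'i \<Rightarrow> 'i free_star_algebra" where
  "fgen i = Poly_Mapping.single (Word [Gen i]) 1"

definition fscale :: "complex \<Rightarrow> 'i free_star_algebra \<Rightarrow> 'i free_star_algebra" where
  "fscale c f = Poly_Mapping.single 0 c * f"

fun letter_star :: "'i letter \<Rightarrow> 'i letter" where
  "letter_star (Gen i) = Gen_star i"
| "letter_star (Gen_star i) = Gen i"

definition word_star :: "'i star_word \<Rightarrow> 'i star_word" where
  "word_star w = Word (rev (map letter_star (letters w)))"

definition fstar :: "'i free_star_algebra \<Rightarrow> 'i free_star_algebra" where
  "fstar f = (\<Sum>w\<in>Poly_Mapping.keys f.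
     Poly_Mapping.single (word_star w) (cnj (Poly_Mapping.lookup f w)))"

fun letter_eval :: "('i \<Rightarrow> 'a::cstar_algebra) \<Rightarrow> 'i letter \<Rightarrow> 'a" where
  "letter_eval T (Gen i) = T i"
| "letter_eval T (Gen_star i) = star (T i)"

definition word_eval :: "('i \<Rightarrow> 'a::cstar_algebra) \<Rightarrow> 'i star_word \<Rightarrow> 'a" where
  "word_eval T w = prod_list (map (letter_eval T) (letters w))"

text \<open>The *-homomorphism from the free *-algebra determined by the values \<open>T i\<close> of the generators.\<close>

definition feval :: "('i \<Rightarrow> 'a::cstar_algebra) \<Rightarrow> 'i free_star_algebra \<Rightarrow> 'a" where
  "feval T f = (\<Sum>w\<in>Poly_Mapping.keys f. Poly_Mapping.lookup f w *\<^sub>C word_eval T w)"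

lemma word_eval_simps [simp]:
  "word_eval T 0 = 1" "word_eval T (v + w) = word_eval T v * word_eval T w"
  by (auto simp: word_eval_def zero_star_word_def plus_star_word_def)

lemma letter_eval_star: "letter_eval T (letter_star l) = star (letter_eval T l)"
  by (cases l) (auto simp: star_star)

lemma word_eval_star: "word_eval T (word_star w) = star (word_eval T w)"
proof -
  have "prod_list (rev (map (letter_eval T \<circ> letter_star) l)) = star (prod_list (map (letter_eval T) l))" for l
    by (induction l) (auto simp: star_mult letter_eval_star)
  then show ?thesis by (simp add: word_eval_def word_star_def rev_map)
qed

lemma feval_superset:
  assumes "finite K" "Poly_Mapping.keys f \<subseteq> K"
  shows "feval T f = (\<Sum>w\<in>K. Poly_Mapping.lookup f w *\<^sub>C word_eval T w)"
  unfolding feval_def using assms by (intro sum.mono_neutral_left) (auto simp: in_keys_iff)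

lemma feval_add: "feval T (f + g) = feval T f + feval T g"
proof -
  let ?K = "Poly_Mapping.keys f \<union> Poly_Mapping.keys g"
  have "feval T (f + g) = (\<Sum>w\<in>?K. Poly_Mapping.lookup (f + g) w *\<^sub>C word_eval T w)"
    by (intro feval_superset) (auto simp: Poly_Mapping.keys_add)
  also have "\<dots> = feval T f + feval T g"
    by (subst (1 2) feval_superset[where K = ?K])
      (auto simp: lookup_add scaleC_add_left sum.distrib)
  finally show ?thesis .
qed

lemma additive_feval: "Modules.additive (feval T)"
  by (simp add: Modules.additive_def feval_add)

lemmas feval_zero [simp] = Modules.additive.zero[OF additive_feval]
lemmas feval_diff = Modules.additive.diff[OF additive_feval]
lemmas feval_sum = Modules.additive.sum[OF additive_feval]

lemma feval_single [simp]: "feval T (Poly_Mapping.single w c) = c *\<^sub>C word_eval T w"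
  by (subst feval_superset[where K = "{w}"]) (auto split: if_splits)

lemma free_expansion:
  "(f :: 'i free_star_algebra)
     = (\<Sum>w\<in>Poly_Mapping.keys f. Poly_Mapping.single w (Poly_Mapping.lookup f w))"
  by (rule poly_mapping_eqI) (auto simp: lookup_sum lookup_single when_def in_keys_iff)

lemma feval_mult: "feval T (f * g) = feval T f * feval T g"
proof -
  have "feval T (f * g) = feval T ((\<Sum>v\<in>Poly_Mapping.keys f. Poly_Mapping.single v (Poly_Mapping.lookup f v))
      * (\<Sum>w\<in>Poly_Mapping.keys g. Poly_Mapping.single w (Poly_Mapping.lookup g w)))"
    using free_expansion[of f] free_expansion[of g] by simp
  also have "\<dots> = feval T f * feval T g"
    by (simp add: sum_product feval_sum mult_single feval_def[of T f] feval_def[of T g]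
        scaleC_mult_left scaleC_mult_right scaleC_scaleC mult.commute)
  finally show ?thesis .
qed

lemma feval_one [simp]: "feval T 1 = 1"
  using feval_single[of T 0 1] by simp

lemma feval_fscale: "feval T (fscale c f) = c *\<^sub>C feval T f"
  by (simp add: fscale_def feval_mult scaleC_mult_left)

lemma feval_fstar: "feval T (fstar f) = star (feval T f)"
  by (simp add: fstar_def feval_sum feval_def[of T f] star_sum star_scaleC word_eval_star)

lemma feval_fgen [simp]: "feval T (fgen i) = T i"
  by (simp add: fgen_def word_eval_def)

lemma unital_star_hom_feval:
  assumes \<phi>: "unital_star_hom \<phi>"
  shows "\<phi> (feval T f) = feval (\<lambda>i. \<phi> (T i)) f"
proof -
  note h = unital_star_homD[OF \<phi>]
  interpret linear \<phi> by (rule unital_star_hom_linear[OF \<phi>])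
  have l: "\<phi> (letter_eval T l) = letter_eval (\<lambda>i. \<phi> (T i)) l" for l
    by (cases l) (auto simp: h)
  have "\<phi> (prod_list (map (letter_eval T) ls)) = prod_list (map (letter_eval (\<lambda>i. \<phi> (T i))) ls)" for ls
    by (induction ls) (auto simp: h l)
  then show ?thesis by (simp add: feval_def sum h word_eval_def)
qed

definition cstar_seminorm :: "('i free_star_algebra \<Rightarrow> real) \<Rightarrow> bool" where
  "cstar_seminorm p \<longleftrightarrow>
     (\<forall>f g. p (f + g) \<le> p f + p g) \<and> (\<forall>c f. p (fscale c f) = cmod c * p f) \<and>
     (\<forall>f g. p (f * g) \<le> p f * p g) \<and> (\<forall>f. p (fstar f * f) = (p f)\<^sup>2)"


section \<open>The Cuntz algebra\<close>

definition cuntz_family :: "('n::finite \<Rightarrow> 'a::cstar_algebra) \<Rightarrow> bool" where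
  "cuntz_family S \<longleftrightarrow> (\<forall>i. star (S i) * S i = 1) \<and> (\<Sum>i\<in>UNIV. S i * star (S i)) = 1"

text \<open>The universal C*-algebra on generators subject to relations is the completion of the free
  *-algebra with respect to the largest C*-seminorm annihilating the relations.  So \<open>'a\<close>, with
  distinguished generators \<open>S i\<close>, is the Cuntz algebra on \<open>CARD('n)\<close> isometries iff the \<open>S i\<close> satisfy
  the relations, the *-polynomials in them are dense, and the norms of the *-polynomials are given
  by that seminorm.  The universal property with respect to arbitrary unital C*-algebras is
  \<open>cuntz_algebra_universal\<close> below.\<close>

definition cuntz_seminorm :: "('n::finite free_star_algebra \<Rightarrow> real) \<Rightarrow> bool" where
  "cuntz_seminorm p \<longleftrightarrow> cstar_seminorm p \<and> (\<forall>i. p (fstar (fgen i) * fgen i - 1) = 0) \<and>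
     p ((\<Sum>i\<in>UNIV. fgen i * fstar (fgen i)) - 1) = 0"

definition is_cuntz_algebra :: "('n::finite \<Rightarrow> 'a::cstar_algebra) \<Rightarrow> bool" where
  "is_cuntz_algebra S \<longleftrightarrow> cuntz_family S \<and> closure (range (feval S)) = UNIV \<and>
     (\<forall>p f. cuntz_seminorm p \<longrightarrow> p f \<le> norm (feval S f))"

lemma cuntz_seminorm_feval:
  fixes T :: "'n::finite \<Rightarrow> 'b::cstar_algebra"
  assumes "cuntz_family T"
  shows "cuntz_seminorm (\<lambda>f. norm (feval T f))"
  using assms unfolding cuntz_seminorm_def cstar_seminorm_def cuntz_family_def
  by (simp add: feval_add norm_triangle_ineq feval_fscale norm_scaleC feval_mult norm_mult_ineq
      feval_fstar cstar_identity feval_diff feval_sum)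

theorem cuntz_algebra_universal:
  fixes S :: "'n::finite \<Rightarrow> 'a::cstar_algebra" and T :: "'n \<Rightarrow> 'b::cstar_algebra"
  assumes S: "is_cuntz_algebra S" and T: "cuntz_family T"
  shows "\<exists>!\<phi>. unital_star_hom \<phi> \<and> (\<forall>i. \<phi> (S i) = T i)"
proof (rule ex_ex1I)
  have dense: "closure (range (feval S)) = UNIV"
    and le: "norm (feval T f) \<le> norm (feval S f)" for f
    using S cuntz_seminorm_feval[OF T] unfolding is_cuntz_algebra_def by blast+
  have wd: "feval T f = feval T g" if "feval S f = feval S g" for f g
    using le[of "f - g"] that by (simp add: feval_diff)
  define h where "h x = feval T (SOME f. feval S f = x)" for x
  have h: "h (feval S f) = feval T f" for f
    unfolding h_def by (rule wd) (rule someI, rule refl)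
  have "dist (h x) (h y) \<le> 1 * dist x y" if "x \<in> range (feval S)" "y \<in> range (feval S)" for x y
    using that le by (auto simp: h dist_norm simp flip: feval_diff)
  then have "1-lipschitz_on (range (feval S)) h" by (intro lipschitz_onI) auto
  then have "uniformly_continuous_on (range (feval S)) h"
    by (rule lipschitz_on_uniformly_continuous)
  then obtain \<phi> where "uniformly_continuous_on (closure (range (feval S))) \<phi>"
    and \<phi>h: "\<And>x. x \<in> range (feval S) \<Longrightarrow> h x = \<phi> x"
    by (rule uniformly_continuous_on_extension_on_closure) blast
  then have cont: "continuous_on UNIV \<phi>"
    using dense uniformly_continuous_imp_continuous by auto
  have \<phi>: "\<phi> (feval S f) = feval T f" for f using h \<phi>h by (metis rangeI)
  have approx: "\<exists>s. (\<lambda>m. feval S (s m)) \<longlonglongrightarrow> x \<and> (\<lambda>m. feval T (s m)) \<longlonglongrightarrow> \<phi> x" for x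
  proof -
    have "x \<in> closure (range (feval S))" using dense by simp
    then obtain z where z: "\<And>m. z m \<in> range (feval S)" "z \<longlonglongrightarrow> x"
      unfolding closure_sequential by blast
    then have "\<forall>m. \<exists>f. z m = feval S f" by blast
    then obtain s where s: "\<And>m. z m = feval S (s m)" by metis
    then have zs: "z = (\<lambda>m. feval S (s m))" by blast
    have "(\<lambda>m. \<phi> (z m)) \<longlonglongrightarrow> \<phi> x"
      using cont z(2) by (intro continuous_on_tendsto_compose[OF cont]) auto
    then have "(\<lambda>m. feval T (s m)) \<longlonglongrightarrow> \<phi> x" by (simp add: s \<phi>)
    with z(2) zs show ?thesis by blast
  qed
  have "\<phi> (x + y) = \<phi> x + \<phi> y \<and> \<phi> (x * y) = \<phi> x * \<phi> y \<and> \<phi> (c *\<^sub>C x) = c *\<^sub>C \<phi> x \<and>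
      \<phi> (star x) = star (\<phi> x)" for x y c
  proof -
    obtain s where s: "(\<lambda>m. feval S (s m)) \<longlonglongrightarrow> x" "(\<lambda>m. feval T (s m)) \<longlonglongrightarrow> \<phi> x"
      using approx by blast
    obtain t where t: "(\<lambda>m. feval S (t m)) \<longlonglongrightarrow> y" "(\<lambda>m. feval T (t m)) \<longlonglongrightarrow> \<phi> y"
      using approx by blast
    have lim: "\<phi> z = w" if "(\<lambda>m. feval S (r m)) \<longlonglongrightarrow> z" "(\<lambda>m. feval T (r m)) \<longlonglongrightarrow> w" for r z w
    proof (rule LIMSEQ_unique)
      have "(\<lambda>m. \<phi> (feval S (r m))) \<longlonglongrightarrow> \<phi> z"
        using that(1) by (intro continuous_on_tendsto_compose[OF cont]) auto
      then show "(\<lambda>m. feval T (r m)) \<longlonglongrightarrow> \<phi> z" by (simp add: \<phi>)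
    qed (rule that(2))
    show ?thesis
    proof (intro conjI)
      show "\<phi> (x + y) = \<phi> x + \<phi> y"
        by (rule lim[of "\<lambda>m. s m + t m"]) (auto simp: feval_add intro!: tendsto_intros s t)
      show "\<phi> (x * y) = \<phi> x * \<phi> y"
        by (rule lim[of "\<lambda>m. s m * t m"]) (auto simp: feval_mult intro!: tendsto_intros s t)
      show "\<phi> (c *\<^sub>C x) = c *\<^sub>C \<phi> x"
        by (rule lim[of "\<lambda>m. fscale c (s m)"])
          (auto simp: feval_fscale intro!: bounded_linear.tendsto[OF bounded_linear_scaleC] s)
      show "\<phi> (star x) = star (\<phi> x)"
        by (rule lim[of "\<lambda>m. fstar (s m)"])
          (auto simp: feval_fstar intro!: bounded_linear.tendsto[OF bounded_linear_star] s)
    qed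
  qed
  moreover have "\<phi> 1 = 1" using \<phi>[of 1] by simp
  moreover have "\<phi> (S i) = T i" for i using \<phi>[of "fgen i"] by simp
  ultimately show "\<exists>\<phi>. unital_star_hom \<phi> \<and> (\<forall>i. \<phi> (S i) = T i)"
    unfolding unital_star_hom_def by blast
next
  fix \<phi> \<psi> :: "'a \<Rightarrow> 'b"
  assume \<phi>: "unital_star_hom \<phi> \<and> (\<forall>i. \<phi> (S i) = T i)" and \<psi>: "unital_star_hom \<psi> \<and> (\<forall>i. \<psi> (S i) = T i)"
  have cont: "continuous_on UNIV \<theta>" if "unital_star_hom \<theta>" for \<theta> :: "'a \<Rightarrow> 'b"
  proof -
    interpret linear \<theta> by (rule unital_star_hom_linear[OF that])
    have "1-lipschitz_on UNIV \<theta>"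
      by (rule lipschitz_onI)
        (auto simp: dist_norm diff[symmetric] unital_star_hom_contractive[OF that])
    then show ?thesis by (rule lipschitz_on_continuous_on)
  qed
  have "\<phi> x = \<psi> x" for x
  proof -
    have "x \<in> closure (range (feval S))" using S by (simp add: is_cuntz_algebra_def)
    then obtain z where z: "\<And>m. z m \<in> range (feval S)" "z \<longlonglongrightarrow> x"
      unfolding closure_sequential by blast
    have "\<phi> (z m) = \<psi> (z m)" for m
      using z(1)[of m] \<phi> \<psi> by (auto simp: unital_star_hom_feval)
    moreover have "(\<lambda>m. \<phi> (z m)) \<longlonglongrightarrow> \<phi> x"
      using \<phi> z(2) by (intro continuous_on_tendsto_compose[OF cont]) auto
    moreover have "(\<lambda>m. \<psi> (z m)) \<longlonglongrightarrow> \<psi> x"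
      using \<psi> z(2) by (intro continuous_on_tendsto_compose[OF cont]) auto
    ultimately show ?thesis by (simp add: LIMSEQ_unique)
  qed
  then show "\<phi> = \<psi>" by blast
qed


subsection \<open>Automorphisms, inner and outer\<close>

definition cstar_aut :: "('a::cstar_algebra \<Rightarrow> 'a) monoid" where
  "cstar_aut = \<lparr>carrier = {\<phi>. unital_star_hom \<phi> \<and> bij \<phi>}, mult = (\<circ>), one = id\<rparr>"

definition inner_auts :: "('a::cstar_algebra \<Rightarrow> 'a) set" where
  "inner_auts = {(\<lambda>x. w * x * star w) | w. unitary w}"

definition cstar_out :: "('a::cstar_algebra \<Rightarrow> 'a) set monoid" where
  "cstar_out = cstar_aut Mod inner_auts"

definition out_proj :: "('a::cstar_algebra \<Rightarrow> 'a) \<Rightarrow> ('a \<Rightarrow> 'a) set" where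
  "out_proj \<phi> = inner_auts #>\<^bsub>cstar_aut\<^esub> \<phi>"

subsection \<open>Permutation endomorphisms\<close>

text \<open>Throughout, \<open>S\<close> is the family of canonical generators and \<open>UNIV :: 'n set\<close> plays the role of
  the index set of \<open>n = CARD('n)\<close> elements.\<close>

definition cuntz_endo :: "('n::finite \<Rightarrow> 'a::cstar_algebra) \<Rightarrow> 'a \<Rightarrow> 'a \<Rightarrow> 'a" where
  "cuntz_endo S u = (THE \<phi>. unital_star_hom \<phi> \<and> (\<forall>i. \<phi> (S i) = u * S i))"

lemma cuntz_family_unitary_mult:
  assumes "cuntz_family S" "unitary u"
  shows "cuntz_family (\<lambda>i. u * S i)"
proof -
  have "star (u * S i) * (u * S i) = star (S i) * (star u * u) * S i" for i
    by (simp add: star_mult mult.assoc)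
  moreover have "(\<Sum>i\<in>UNIV. (u * S i) * star (u * S i)) = u * (\<Sum>i\<in>UNIV. S i * star (S i)) * star u"
    by (simp add: star_mult mult.assoc sum_distrib_left sum_distrib_right)
  ultimately show ?thesis
    using assms by (simp add: cuntz_family_def unitary_def)
qed

lemma cuntz_endo_works:
  assumes "is_cuntz_algebra S" "unitary u"
  shows "unital_star_hom (cuntz_endo S u)" "cuntz_endo S u (S i) = u * S i"
proof -
  have "cuntz_family (\<lambda>i. u * S i)"
    using assms cuntz_family_unitary_mult unfolding is_cuntz_algebra_def by blast
  from theI'[OF cuntz_algebra_universal[OF assms(1) this]]
  show "unital_star_hom (cuntz_endo S u)" "cuntz_endo S u (S i) = u * S i"
    unfolding cuntz_endo_def by blast+
qed

definition perm_unitary :: "('n::finite \<Rightarrow> 'a::cstar_algebra) \<Rightarrow> ('n \<times> 'n \<Rightarrow> 'n \<times> 'n) \<Rightarrow> 'a" where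
  "perm_unitary S u = (let W = (\<lambda>(k, j). S k * S j) in \<Sum>\<alpha>\<in>UNIV. W (u \<alpha>) * star (W \<alpha>))"

definition perm_endo ::
    "('n::finite \<Rightarrow> 'a::cstar_algebra) \<Rightarrow> ('n \<times> 'n \<Rightarrow> 'n \<times> 'n) \<Rightarrow> 'a \<Rightarrow> 'a" where
  "perm_endo S u = cuntz_endo S (perm_unitary S u)"

text \<open>The set of automorphisms induced by the permutations of pairs.\<close>

definition perm2_auts :: "('n::finite \<Rightarrow> 'a::cstar_algebra) \<Rightarrow> ('a \<Rightarrow> 'a) set" where
  "perm2_auts S = {perm_endo S u | u. u permutes UNIV \<and> perm_endo S u \<in> carrier cstar_aut}"

definition R_perms :: "'n \<Rightarrow> ('n \<times> 'n \<Rightarrow> 'n \<times> 'n) set" where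
  "R_perms i = {u. u permutes UNIV \<and> (\<forall>k j. k \<noteq> i \<or> j = i \<longrightarrow> u (k, j) = (k, j))}"

definition R_check_perms :: "'n \<Rightarrow> ('n \<times> 'n \<Rightarrow> 'n \<times> 'n) set" where
  "R_check_perms i = {u. u permutes UNIV \<and> (\<exists>\<sigma>. \<sigma> permutes (UNIV - {i}) \<and>
     (\<forall>k j. k \<noteq> i \<and> j \<noteq> i \<longrightarrow> u (k, j) = (k, \<sigma> j)) \<and>
     (\<forall>k j. k = i \<or> j = i \<longrightarrow> u (k, j) = (k, j)))}"

definition C_perms :: "'n \<Rightarrow> ('n \<times> 'n \<Rightarrow> 'n \<times> 'n) set" where
  "C_perms i = {u. u permutes UNIV \<and> (\<forall>k j. j \<noteq> i \<or> k = i \<longrightarrow> u (k, j) = (k, j))}"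

definition C_check_perms :: "'n \<Rightarrow> ('n \<times> 'n \<Rightarrow> 'n \<times> 'n) set" where
  "C_check_perms i = {u. u permutes UNIV \<and> (\<exists>\<sigma>. \<sigma> permutes (UNIV - {i}) \<and>
     (\<forall>k j. k \<noteq> i \<and> j \<noteq> i \<longrightarrow> u (k, j) = (\<sigma> k, j)) \<and>
     (\<forall>k j. k = i \<or> j = i \<longrightarrow> u (k, j) = (k, j)))}"

definition Q :: "('n::finite \<Rightarrow> 'a::cstar_algebra) \<Rightarrow> 'n \<Rightarrow> ('a \<Rightarrow> 'a) set" where
  "Q S i = generate cstar_aut (perm_endo S ` (R_perms i \<union> R_check_perms i))"

definition Q' :: "('n::finite \<Rightarrow> 'a::cstar_algebra) \<Rightarrow> 'n \<Rightarrow> ('a \<Rightarrow> 'a) set" where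
  "Q' S i = generate cstar_aut (perm_endo S ` (C_perms i \<union> C_check_perms i))"

end

theory Submission
  imports Defs
begin

text \<open>Let \<open>V p = \<Sum>j. S (p j) * star (S j)\<close>.  For permutations \<open>p\<close>, \<open>q\<close> fixing \<open>i\<close>, the endomorphism
  \<open>S i \<mapsto> S i * V p\<close>, \<open>S k \<mapsto> S k * V q\<close> (\<open>k \<noteq> i\<close>) fixes every \<open>V r\<close> with \<open>r i = i\<close>, so composition is
  componentwise in \<open>(p, q)\<close>, and these maps form \<open>Q S i\<close>.  Likewise \<open>Q' S i\<close> consists of the
  endomorphisms \<open>S k \<mapsto> S (p k) * P + S (q k) * (1 - P)\<close>, which fix \<open>P = S i * star (S i)\<close>.
  All of them act on infinite words in the generators, and they map periodic words to eventually
  periodic ones.  Suppose that \<open>w\<close> intertwines two endomorphisms that send the same periodic word to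
  words with periods \<open>\<beta>\<close> and \<open>\<gamma>\<close>.  Then, for all \<open>m\<close>, \<open>w\<close> equals
  \<open>star Y * star (S\<^sub>\<gamma> ^ m) * x * S\<^sub>\<beta> ^ m * Y'\<close> with \<open>x\<close>, \<open>Y\<close>, \<open>Y'\<close> independent of \<open>m\<close>, and this tends to
  \<open>0\<close> if \<open>\<beta>\<close> contains a letter that \<open>\<gamma>\<close> lacks.  Hence automorphisms that differ by an inner one act
  compatibly on the words \<open>kkk\<dots>\<close>, \<open>iaia\<dots>\<close> and \<open>iabiab\<dots>\<close>, which is enough to separate all the
  classes in question.\<close>

section \<open>Orthogonality of the ranges\<close>

lemma scaleC_minus_left: "(- c) *\<^sub>C x = - (c *\<^sub>C (x::'a::cstar_algebra))"
  using scaleC_add_left[of "- c" c x] by (simp add: eq_neg_iff_add_eq_0)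

lemma scaleC_diff_right: "c *\<^sub>C (x - y) = c *\<^sub>C x - c *\<^sub>C (y::'a::cstar_algebra)"
  using Modules.additive.diff[OF additive_scaleC_right] .

text \<open>\<open>1 + (1 + \<i>) e\<close> is the average of \<open>(1 + e)\<^sup>2\<close> and \<open>(1 + \<i> e)\<^sup>2\<close>.\<close>

lemma norm_one_plus_i_mult_le:
  fixes e :: "'a::cstar_algebra"
  assumes "norm (1 + e) \<le> 1" "norm (1 + \<i> *\<^sub>C e) \<le> 1"
  shows "norm (1 + (1 + \<i>) *\<^sub>C e) \<le> 1"
proof -
  have "2 *\<^sub>R (1 + (1 + \<i>) *\<^sub>C e) = (1 + e) * (1 + e) + (1 + \<i> *\<^sub>C e) * (1 + \<i> *\<^sub>C e)"
    by (simp add: algebra_simps scaleC_add_left scaleC_mult_left scaleC_mult_right scaleC_scaleC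
        scaleC_add_right scaleR_2 scaleC_minus_left)
  then have "2 * norm (1 + (1 + \<i>) *\<^sub>C e)
      = norm ((1 + e) * (1 + e) + (1 + \<i> *\<^sub>C e) * (1 + \<i> *\<^sub>C e))"
    by (metis norm_scaleR abs_numeral)
  also have "\<dots> \<le> norm ((1 + e) * (1 + e)) + norm ((1 + \<i> *\<^sub>C e) * (1 + \<i> *\<^sub>C e))"
    by (rule norm_triangle_ineq)
  also have "\<dots> \<le> norm (1 + e) * norm (1 + e) + norm (1 + \<i> *\<^sub>C e) * norm (1 + \<i> *\<^sub>C e)"
    by (intro add_mono norm_mult_ineq)
  also have "\<dots> \<le> 1 * 1 + 1 * 1"
    using assms by (intro add_mono mult_mono) auto
  finally show ?thesis by simp
qed

text \<open>Iterating the averaging lemma keeps the points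
  \<open>1 + ((1 + \<i>) ^ m * \<i> ^ k) *\<^sub>C e\<close> in the unit ball, although the modulus
  of \<open>(1 + \<i>) ^ m\<close> is unbounded.\<close>

lemma zero_of_norm_one_plus_le:
  fixes e :: "'a::cstar_algebra"
  assumes "norm (1 + e) \<le> 1" "norm (1 + \<i> *\<^sub>C e) \<le> 1" "norm (1 - e) \<le> 1" "norm (1 - \<i> *\<^sub>C e) \<le> 1"
  shows "e = 0"
proof (rule ccontr)
  assume "e \<noteq> 0"
  \<comment> \<open>All rotations by powers of \<i> are carried along, because averaging needs a
    point together with its rotation by \<i>.\<close>
  have *: "norm (1 + ((1 + \<i>) ^ m * \<i> ^ k) *\<^sub>C e) \<le> 1" for m k
  proof (induction m arbitrary: k)
    case 0
    have "\<i> ^ k \<in> {1, \<i>, -1, -\<i>}"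
      by (induction k) auto
    then show ?case using assms by (auto simp: scaleC_minus_left)
  next
    case (Suc m)
    show ?case
      using norm_one_plus_i_mult_le[of "((1 + \<i>) ^ m * \<i> ^ k) *\<^sub>C e"] Suc[of k] Suc[of "Suc k"]
      by (simp add: scaleC_scaleC mult_ac)
  qed
  have bound: "2 ^ m * norm e \<le> 2" for m
  proof -
    have "cmod ((1 + \<i>) ^ (2 * m)) = 2 ^ m"
    proof -
      have "(1 + \<i>)\<^sup>2 = 2 * \<i>" by (simp add: power2_eq_square algebra_simps)
      then show ?thesis by (simp add: power_mult norm_power norm_mult)
    qed
    then have "2 ^ m * norm e = norm (((1 + \<i>) ^ (2 * m)) *\<^sub>C e)"
      by (simp add: norm_scaleC)
    also have "\<dots> \<le> norm (1 + ((1 + \<i>) ^ (2 * m)) *\<^sub>C e) + norm (1::'a)"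
      using norm_triangle_ineq4[of "1 + ((1 + \<i>) ^ (2 * m)) *\<^sub>C e" 1] by simp
    finally show ?thesis using *[of "2 * m" 0] by simp
  qed
  obtain m where "2 / norm e < 2 ^ m"
    using real_arch_pow[of 2 "2 / norm e"] by auto
  then show False using bound[of m] \<open>e \<noteq> 0\<close> by (simp add: field_simps)
qed

lemma star_diff: "star (x - y) = star x - star (y::'a::cstar_algebra)"
  using Modules.additive.diff[OF additive_star] .

text \<open>The unit is an extreme point of the unit ball.\<close>

lemma selfadjoint_zero_of_norm_le:
  fixes y :: "'a::cstar_algebra"
  assumes sa: "star y = y" and "norm (1 + y) \<le> 1" "norm (1 - y) \<le> 1"
  shows "y = 0"
proof -
  \<comment> \<open>The mean of the squares of \<open>1 + y\<close> and \<open>1 - y\<close> is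
    \<open>1 + y * y\<close>, which is also
    \<open>star (1 + \<i> *\<^sub>C y) * (1 + \<i> *\<^sub>C y)\<close>. The C*-identity thus
    supplies the bounds in the imaginary directions.\<close>
  have "2 *\<^sub>R (1 + y * y) = (1 + y) * (1 + y) + (1 - y) * (1 - y)"
    by (simp add: algebra_simps scaleR_2)
  then have "2 * norm (1 + y * y) = norm ((1 + y) * (1 + y) + (1 - y) * (1 - y))"
    by (metis norm_scaleR abs_numeral)
  also have "\<dots> \<le> norm ((1 + y) * (1 + y)) + norm ((1 - y) * (1 - y))"
    by (rule norm_triangle_ineq)
  also have "\<dots> \<le> norm (1 + y) * norm (1 + y) + norm (1 - y) * norm (1 - y)"
    by (intro add_mono norm_mult_ineq)
  also have "\<dots> \<le> 1 * 1 + 1 * 1"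
    using assms by (intro add_mono mult_mono) auto
  finally have le: "norm (1 + y * y) \<le> 1" by simp
  have st: "star (1 + \<i> *\<^sub>C y) = 1 - \<i> *\<^sub>C y"
    by (simp add: star_add star_scaleC sa scaleC_minus_left)
  have "star (1 + \<i> *\<^sub>C y) * (1 + \<i> *\<^sub>C y) = 1 + y * y"
    unfolding st by (simp add: algebra_simps scaleC_mult_left scaleC_mult_right scaleC_scaleC
        scaleC_minus_left scaleC_diff_right)
  then have "(norm (1 + \<i> *\<^sub>C y))\<^sup>2 \<le> 1"
    using cstar_identity[of "1 + \<i> *\<^sub>C y"] le by simp
  then have "norm (1 + \<i> *\<^sub>C y) \<le> 1"
    by (simp add: power_le_one_iff)
  moreover from this have "norm (1 - \<i> *\<^sub>C y) \<le> 1"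
    by (metis st norm_star)
  ultimately show ?thesis using assms(2,3) by (intro zero_of_norm_one_plus_le)
qed

lemma norm_projection_le:
  fixes p :: "'a::cstar_algebra"
  assumes "star p = p" "p * p = p"
  shows "norm p \<le> 1"
proof -
  have "norm p * (1 - norm p) = 0"
    using cstar_identity[of p] unfolding assms power2_eq_square right_diff_distrib by simp
  then show ?thesis by auto
qed

lemma star_mult_self_eq_0_iff: "star x * x = 0 \<longleftrightarrow> x = (0::'a::cstar_algebra)"
  using cstar_identity[of x] by auto

text \<open>Compressing the sum relation by \<open>S i\<close> gives elements \<open>q j\<close>
  with sum 1 and \<open>q i = 1\<close>, so the others sum to 0. Norm bounds on
  \<open>1 - q j\<close> play the part of positivity, and extremality of the unit forces
  \<open>q k = 0\<close>; this is \<open>star x * x = 0\<close> for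
  \<open>x = star (S k) * S i\<close>.\<close>

lemma cuntz_family_star_mult:
  fixes S :: "'n::finite \<Rightarrow> 'a::cstar_algebra"
  assumes S: "cuntz_family S"
  shows "star (S k) * S i = (if k = i then 1 else 0)"
proof (cases "k = i")
  case False
  have iso: "star (S j) * S j = 1" for j
    using S by (auto simp: cuntz_family_def)
  have sum1: "(\<Sum>j\<in>UNIV. S j * star (S j)) = 1"
    using S by (auto simp: cuntz_family_def)
  have nS: "norm (S j) = 1" for j by (rule norm_unitary_le[OF iso])
  define q where "q j = star (S i) * (S j * star (S j)) * S i" for j
  have q_sum: "(\<Sum>j\<in>UNIV. q j) = 1"
    unfolding q_def by (simp add: sum1 iso flip: sum_distrib_left sum_distrib_right)
  have "q i = (star (S i) * S i) * (star (S i) * S i)" by (simp only: q_def mult.assoc)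
  then have qi: "q i = 1" by (simp add: iso)
  define I where "I = UNIV - {i, k}"
  have "(\<Sum>j\<in>UNIV. q j) = q i + (q k + (\<Sum>j\<in>I. q j))"
  proof -
    have "(\<Sum>j\<in>UNIV. q j) = q i + (\<Sum>j\<in>UNIV - {i}. q j)"
      by (rule sum.remove) auto
    also have "(\<Sum>j\<in>UNIV - {i}. q j) = q k + (\<Sum>j\<in>UNIV - {i} - {k}. q j)"
      using False by (intro sum.remove) auto
    also have "UNIV - {i} - {k} = I" by (auto simp: I_def)
    finally show ?thesis .
  qed
  then have qk: "q k = - (\<Sum>j\<in>I. q j)"
    using q_sum qi by (simp add: eq_neg_iff_add_eq_0)
  \<comment> \<open>\<open>1 - q j\<close> is the compression by the isometry \<open>S i\<close> of
    the projection complementary to the range of \<open>S j\<close>.\<close>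
  have norm_q: "norm (1 - q j) \<le> 1" for j
  proof -
    define p where "p = 1 - S j * star (S j)"
    have "(S j * star (S j)) * (S j * star (S j)) = S j * (star (S j) * S j) * star (S j)"
      by (simp only: mult.assoc)
    then have "norm p \<le> 1"
      by (intro norm_projection_le)
        (simp_all add: p_def star_diff star_mult star_star iso algebra_simps)
    have "1 - q j = star (S i) * p * S i"
      by (simp add: q_def p_def algebra_simps iso)
    also have "norm \<dots> \<le> norm (star (S i)) * norm p * norm (S i)"
      by (meson norm_mult_ineq mult_right_mono norm_ge_zero order_trans)
    finally show ?thesis using \<open>norm p \<le> 1\<close> by (simp add: nS)
  qed
  \<comment> \<open>\<open>1 + y\<close> and \<open>1 - y\<close> are both convex combinations of \<open>1\<close> and the contractions \<open>1 - q j\<close>.\<close>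
  define y where "y = (1 / (card I + 1)) *\<^sub>R q k"
  have y_scale: "(card I + 1) *\<^sub>R y = q k" by (simp add: y_def)
  have "norm (1 - y) \<le> 1"
  proof -
    have "(card I + 1) *\<^sub>R (1 - y) = real (card I) *\<^sub>R 1 + (1 - q k)"
      using y_scale by (simp add: algebra_simps)
    then have "(card I + 1) * norm (1 - y) = norm (real (card I) *\<^sub>R 1 + (1 - q k))"
      by (metis norm_scaleR abs_of_nat)
    also have "\<dots> \<le> card I + 1"
      using norm_q[of k] by (intro order_trans[OF norm_triangle_ineq]) simp
    finally show ?thesis by simp
  qed
  moreover have "norm (1 + y) \<le> 1"
  proof -
    have "(card I + 1) *\<^sub>R (1 + y) = 1 + (\<Sum>j\<in>I. 1 - q j)"
      using y_scale by (simp add: algebra_simps qk sum_subtractf scaleR_conv_of_real)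
    then have "(card I + 1) * norm (1 + y) = norm (1 + (\<Sum>j\<in>I. 1 - q j))"
      by (metis norm_scaleR abs_of_nat)
    also have "\<dots> \<le> 1 + (\<Sum>j\<in>I. norm (1 - q j))"
      by (intro order_trans[OF norm_triangle_ineq] add_mono sum_norm_le) auto
    also have "\<dots> \<le> 1 + (\<Sum>j\<in>I. 1)"
      by (intro add_mono sum_mono norm_q) auto
    finally show ?thesis by simp
  qed
  moreover have "star y = y"
    by (simp add: y_def q_def star_scaleR star_mult star_star mult.assoc)
  ultimately have "y = 0" by (intro selfadjoint_zero_of_norm_le)
  then have "q k = 0" using y_scale by simp
  then have "star (star (S k) * S i) * (star (S k) * S i) = 0"
    by (simp add: q_def star_mult star_star mult.assoc)
  then have "star (S k) * S i = 0" by (simp only: star_mult_self_eq_0_iff)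
  then show ?thesis using False by simp
qed (use S in \<open>simp add: cuntz_family_def\<close>)

section \<open>Periodic words\<close>

definition gen_word :: "('n \<Rightarrow> 'a::cstar_algebra) \<Rightarrow> 'n list \<Rightarrow> 'a" where
  "gen_word S \<alpha> = prod_list (map S \<alpha>)"

lemma gen_word_simps [simp]:
  "gen_word S [] = 1"
  "gen_word S (k # \<alpha>) = S k * gen_word S \<alpha>"
  "gen_word S (\<alpha> @ \<beta>) = gen_word S \<alpha> * gen_word S \<beta>"
  by (simp_all add: gen_word_def)

lemma gen_word_power: "gen_word S \<alpha> ^ m = gen_word S (concat (replicate m \<alpha>))"
  by (induction m) auto

locale cuntz_generators =
  fixes S :: "'n::finite \<Rightarrow> 'a::cstar_algebra"
  assumes is_cuntz: "is_cuntz_algebra S"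
begin

lemma family: "cuntz_family S"
  using is_cuntz by (simp add: is_cuntz_algebra_def)

lemma star_mult_gen: "star (S k) * S i = (if k = i then 1 else 0)"
  by (rule cuntz_family_star_mult[OF family])

lemma star_mult_gen_mult: "star (S k) * (S i * x) = (if k = i then x else 0)"
  by (simp add: star_mult_gen flip: mult.assoc)

lemma sum_gen: "(\<Sum>k\<in>UNIV. S k * star (S k)) = 1"
  using family by (simp add: cuntz_family_def)

text \<open>Adjacent generators cancel if equal and annihilate if different, so the first mismatch,
  at \<open>t\<close> at the latest, kills the product.\<close>

lemma star_gen_word_mult_eq_0:
  assumes "t < length \<gamma>" "t < length \<eta>" "\<gamma> ! t \<noteq> \<eta> ! t"
  shows "star (gen_word S \<gamma>) * gen_word S \<eta> = 0"
  using assms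
proof (induction t arbitrary: \<gamma> \<eta>)
  case 0
  then show ?case
    by (cases \<gamma>; cases \<eta>) (auto simp: star_mult mult.assoc star_mult_gen_mult)
next
  case (Suc t)
  then show ?case
    by (cases \<gamma>; cases \<eta>) (auto simp: star_mult mult.assoc star_mult_gen_mult)
qed

text \<open>A monomial that does not kill a long word only alters a bounded prefix: a plain letter
  is prepended, a starred one deletes the first letter. The length hypothesis keeps the word from
  running out of letters.\<close>

lemma letters_mult_gen_word:
  assumes "length ls \<le> length \<eta>"
  shows "prod_list (map (letter_eval S) ls) * gen_word S \<eta> = 0 \<or>
    (\<exists>\<mu> d. prod_list (map (letter_eval S) ls) * gen_word S \<eta> = gen_word S (\<mu> @ drop d \<eta>) \<and>
      length \<mu> \<le> length ls \<and> d \<le> length ls)"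
  using assms
proof (induction ls)
  case Nil
  show ?case by (auto intro!: exI[of _ "[]"] exI[of _ 0])
next
  case (Cons l ls)
  define x where "x = prod_list (map (letter_eval S) ls) * gen_word S \<eta>"
  consider "x = 0" | \<mu> d where "x = gen_word S (\<mu> @ drop d \<eta>)"
    "length \<mu> \<le> length ls" "d \<le> length ls"
    using Cons unfolding x_def by auto
  then have "letter_eval S l * x = 0 \<or> (\<exists>\<mu> d. letter_eval S l * x = gen_word S (\<mu> @ drop d \<eta>) \<and>
      length \<mu> \<le> length (l # ls) \<and> d \<le> length (l # ls))"
  proof cases
    case (2 \<mu> d)
    show ?thesis
    proof (cases l)
      case (Gen k)
      with 2 show ?thesis by (intro disjI2 exI[of _ "k # \<mu>"] exI[of _ d]) auto
    next
      case (Gen_star k)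
      show ?thesis
      proof (cases \<mu>)
        case Nil
        have "drop d \<eta> = \<eta> ! d # drop (Suc d) \<eta>"
          using 2(3) Cons.prems by (simp add: Cons_nth_drop_Suc)
        then have "letter_eval S l * x = (if k = \<eta> ! d then gen_word S ([] @ drop (Suc d) \<eta>) else 0)"
          using 2(1) Nil Gen_star by (simp add: star_mult_gen_mult)
        moreover have "length [] \<le> length (l # ls)" "Suc d \<le> length (l # ls)"
          using 2 by auto
        ultimately show ?thesis by metis
      next
        case (Cons c \<nu>)
        have "letter_eval S l * x = (if k = c then gen_word S (\<nu> @ drop d \<eta>) else 0)"
          using 2(1) Cons Gen_star by (simp add: star_mult_gen_mult mult.assoc)
        moreover have "length \<nu> \<le> length (l # ls)" "d \<le> length (l # ls)"
          using 2 Cons by auto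
        ultimately show ?thesis by metis
      qed
    qed
  qed simp
  then show ?case by (simp add: x_def mult.assoc)
qed

text \<open>Some occurrence of \<open>b\<close> in a high power of \<open>\<beta>\<close> lies
  beyond the prefix that \<open>v\<close> can alter. It ends up at a position where the power of
  \<open>\<gamma>\<close> has a letter other than \<open>b\<close>.\<close>

lemma eventually_star_power_mult_word_eq_0:
  assumes b: "b \<in> set \<beta>" "b \<notin> set \<gamma>" and "\<gamma> \<noteq> []"
  shows "\<forall>\<^sub>F m in sequentially. star (gen_word S \<gamma> ^ m) * word_eval S v * gen_word S \<beta> ^ m = 0"
proof -
  define ls where "ls = letters v"
  define L where "L = length ls"
  obtain r where r: "r < length \<beta>" "\<beta> ! r = b"
    using b(1) by (auto simp: in_set_conv_nth)
  define p where "p = length \<beta>"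
  have p: "p > 0" "r < p" using r by (auto simp: p_def)
  \<comment> \<open>\<open>L\<close> bounds both the letters deleted by \<open>v\<close> and those
    prepended. The threshold for \<open>m\<close> makes both powers long enough for the mismatch
    position \<open>t\<close> below.\<close>
  have "star (gen_word S \<gamma> ^ m) * word_eval S v * gen_word S \<beta> ^ m = 0"
    if m: "m \<ge> p * (L + 1) + L + 1" for m
  proof -
    define \<eta> where "\<eta> = concat (replicate m \<beta>)"
    define \<delta> where "\<delta> = concat (replicate m \<gamma>)"
    have len: "length \<eta> = m * p" "length \<delta> = m * length \<gamma>"
      by (simp_all add: \<eta>_def \<delta>_def p_def length_concat sum_list_replicate)
    have Lm: "L < m" using m p by simp
    have m_le: "m \<le> m * p" "m \<le> m * length \<gamma>"
      using p \<open>\<gamma> \<noteq> []\<close> by (simp_all add: Suc_leI)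
    \<comment> \<open>The chosen \<open>b\<close> sits in the copy of \<open>\<beta>\<close> after
      the first \<open>L\<close> copies; these have at least \<open>L\<close> letters, so it
      survives the deletion.\<close>
    have "replicate m \<beta> = replicate L \<beta> @ \<beta> # replicate (m - L - 1) \<beta>"
      using Lm by (metis Suc_diff_Suc diff_diff_left le_add_diff_inverse less_imp_le_nat plus_1_eq_Suc
          add.commute replicate_Suc replicate_add)
    then have "\<eta> = concat (replicate L \<beta>) @ \<beta> @ concat (replicate (m - L - 1) \<beta>)"
      by (simp add: \<eta>_def)
    moreover have "length (concat (replicate L \<beta>)) = p * L"
      by (simp add: p_def length_concat sum_list_replicate)
    ultimately have \<eta>_nth: "\<eta> ! (p * L + r) = b"
      using r by (simp add: nth_append)
    consider "prod_list (map (letter_eval S) ls) * gen_word S \<eta> = 0"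
      | \<mu> d where "prod_list (map (letter_eval S) ls) * gen_word S \<eta> = gen_word S (\<mu> @ drop d \<eta>)"
        "length \<mu> \<le> L" "d \<le> L"
      using letters_mult_gen_word[of ls \<eta>] Lm m_le(1) unfolding L_def len(1) by force
    then have "star (gen_word S \<delta>) * (prod_list (map (letter_eval S) ls) * gen_word S \<eta>) = 0"
    proof cases
      case (2 \<mu> d)
      have dL: "d \<le> p * L" using 2(3) p by (metis le_trans mult_le_mono1 mult_1 Suc_leI One_nat_def)
      \<comment> \<open>The position of the chosen \<open>b\<close> once \<open>d\<close> leading
        letters are replaced by \<open>\<mu>\<close>.\<close>
      define t where "t = length \<mu> + (p * L + r - d)"
      have "t < p * (L + 1) + L"
        using dL p(2) 2(2) by (simp add: t_def)
      then have t: "t < m" using m by simp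
      have "t < length \<delta>"
        unfolding len(2) by (rule order.strict_trans2[OF t m_le(2)])
      moreover have "p * L + r < length \<eta>"
      proof -
        have "p * L + r < p * (L + 1)" using p(2) by simp
        also have "\<dots> \<le> m" using m by simp
        also have "m \<le> length \<eta>" using m_le(1) len(1) by (simp only:)
        finally show ?thesis .
      qed
      then have "t < length (\<mu> @ drop d \<eta>)" using dL by (simp add: t_def)
      moreover have "(\<mu> @ drop d \<eta>) ! t = b"
        unfolding t_def nth_append_length_plus using dL \<eta>_nth \<open>p * L + r < length \<eta>\<close> by simp
      moreover have "\<delta> ! t \<in> set \<gamma>"
      proof -
        have "\<delta> ! t \<in> set \<delta>" using \<open>t < length \<delta>\<close> by simp
        then show ?thesis by (auto simp: \<delta>_def)
      qed
      ultimately have "star (gen_word S \<delta>) * gen_word S (\<mu> @ drop d \<eta>) = 0"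
        using b(2) by (intro star_gen_word_mult_eq_0[of t]) auto
      then show ?thesis unfolding 2(1) .
    qed simp
    then show ?thesis
      by (simp add: gen_word_power word_eval_def ls_def \<eta>_def \<delta>_def mult.assoc)
  qed
  then show ?thesis by (auto simp: eventually_sequentially)
qed

lemma norm_gen_word_power_le: "norm (gen_word S \<alpha> ^ m) \<le> 1"
proof -
  have "norm (gen_word S \<beta>) \<le> 1" for \<beta>
  proof (induction \<beta>)
    case (Cons k \<beta>)
    have "norm (S k) = 1"
      by (rule norm_unitary_le) (simp add: star_mult_gen)
    then show ?case
      using Cons norm_mult_ineq[of "S k" "gen_word S \<beta>"] by simp
  qed simp
  then show ?thesis by (simp add: gen_word_power)
qed

text \<open>For a *-polynomial the product vanishes eventually, since each of its finitely many
  monomials is killed. Density extends this to all \<open>x\<close>, as the outer factors are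
  contractions.\<close>

lemma star_power_mult_tendsto_0:
  assumes b: "b \<in> set \<beta>" "b \<notin> set \<gamma>" and \<gamma>: "\<gamma> \<noteq> []"
  shows "(\<lambda>m. star (gen_word S \<gamma> ^ m) * x * gen_word S \<beta> ^ m) \<longlonglongrightarrow> 0"
proof (rule LIMSEQ_I)
  fix \<epsilon> :: real assume "\<epsilon> > 0"
  define A where "A m = star (gen_word S \<gamma> ^ m)" for m
  define B where "B m = gen_word S \<beta> ^ m" for m
  have "x \<in> closure (range (feval S))"
    using is_cuntz by (simp add: is_cuntz_algebra_def)
  then obtain f where f: "norm (x - feval S f) < \<epsilon>"
    using \<open>\<epsilon> > 0\<close> unfolding closure_approachable by (auto simp: dist_norm norm_minus_commute)
  have "\<forall>\<^sub>F m in sequentially. \<forall>v\<in>Poly_Mapping.keys f. A m * word_eval S v * B m = 0"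
    using eventually_star_power_mult_word_eq_0[OF b \<gamma>]
    by (simp add: eventually_ball_finite A_def B_def)
  then have "\<forall>\<^sub>F m in sequentially. A m * feval S f * B m = 0"
    by eventually_elim
      (simp add: feval_def sum_distrib_left sum_distrib_right scaleC_mult_left scaleC_mult_right)
  then obtain M where M: "\<And>m. m \<ge> M \<Longrightarrow> A m * feval S f * B m = 0"
    by (auto simp: eventually_sequentially)
  have "norm (A m * x * B m - 0) < \<epsilon>" if "m \<ge> M" for m
  proof -
    have "A m * x * B m - 0 = A m * (x - feval S f) * B m"
      using M[OF that] by (simp add: algebra_simps)
    also have "norm \<dots> \<le> norm (A m) * norm (x - feval S f) * norm (B m)"
      by (meson norm_mult_ineq mult_right_mono norm_ge_zero order_trans)
    also have "\<dots> \<le> 1 * norm (x - feval S f) * 1"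
      by (intro mult_mono) (auto simp: A_def B_def norm_gen_word_power_le)
    finally show ?thesis using f by simp
  qed
  then show "\<exists>M. \<forall>m\<ge>M. norm (star (gen_word S \<gamma> ^ m) * x * gen_word S \<beta> ^ m - 0) < \<epsilon>"
    unfolding A_def B_def by blast
qed

text \<open>\<open>\<phi>\<close> maps the infinite word \<open>\<alpha>\<alpha>\<dots>\<close> to \<open>\<beta>\<beta>\<dots>\<close>, up to a fixed distortion at both ends of the
  powers of \<open>\<alpha>\<close>.\<close>

definition tracks :: "('a \<Rightarrow> 'a) \<Rightarrow> 'n list \<Rightarrow> 'n list \<Rightarrow> bool" where
  "tracks \<phi> \<alpha> \<beta> \<longleftrightarrow> (\<exists>X Y. \<forall>m. \<phi> (gen_word S \<alpha>) ^ Suc m = X * gen_word S \<beta> ^ m * Y)"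

text \<open>In a power of \<open>X * gen_word S \<beta> * Y\<close> the inner factors
  \<open>Y * X\<close> cancel. This is the form in which the row automorphisms appear, with
  \<open>X\<close> and \<open>Y\<close> mutually inverse unitaries.\<close>

lemma tracks_similar:
  assumes "\<phi> (gen_word S \<alpha>) = X * gen_word S \<beta> * Y" "Y * X = 1"
  shows "tracks \<phi> \<alpha> \<beta>"
proof -
  have "\<phi> (gen_word S \<alpha>) ^ Suc m = X * gen_word S \<beta> ^ m * (gen_word S \<beta> * Y)" for m
  proof (induction m)
    case (Suc m)
    have "\<phi> (gen_word S \<alpha>) ^ Suc (Suc m) = \<phi> (gen_word S \<alpha>) ^ Suc m * \<phi> (gen_word S \<alpha>)"
      by (rule power_Suc2)
    also have "\<dots> = X * gen_word S \<beta> ^ m * gen_word S \<beta> * (Y * X) * (gen_word S \<beta> * Y)"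
      unfolding Suc unfolding assms(1) by (simp only: mult.assoc)
    finally show ?case by (simp only: assms(2) mult_1_right mult.assoc power_Suc2)
  qed (simp add: assms mult.assoc)
  then show ?thesis unfolding tracks_def by blast
qed

text \<open>Each factor \<open>\<phi> (gen_word S \<alpha>)\<close> followed by another one may be
  replaced by \<open>gen_word S \<beta>\<close>; only the last factor remains. The column
  automorphisms need this form.\<close>

lemma tracks_shift:
  assumes "\<phi> (gen_word S \<alpha>) * \<phi> (gen_word S \<alpha>) = gen_word S \<beta> * \<phi> (gen_word S \<alpha>)"
  shows "tracks \<phi> \<alpha> \<beta>"
proof -
  have "\<phi> (gen_word S \<alpha>) ^ Suc m = 1 * gen_word S \<beta> ^ m * \<phi> (gen_word S \<alpha>)" for m
  proof (induction m)
    case (Suc m)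
    have "\<phi> (gen_word S \<alpha>) ^ Suc (Suc m) = \<phi> (gen_word S \<alpha>) ^ Suc m * \<phi> (gen_word S \<alpha>)"
      by (rule power_Suc2)
    also have "\<dots> = gen_word S \<beta> ^ m * (\<phi> (gen_word S \<alpha>) * \<phi> (gen_word S \<alpha>))"
      unfolding Suc by (simp add: mult.assoc)
    finally show ?case by (simp only: assms mult_1_left mult.assoc power_Suc2)
  qed simp
  then show ?thesis unfolding tracks_def by blast
qed

lemma intertwiner_tracks_subset:
  assumes \<phi>: "unital_star_hom \<phi>" and w: "w \<noteq> 0" "\<And>x. \<phi> x * w = w * \<psi> x"
    and tr: "tracks \<phi> \<alpha> \<gamma>" "tracks \<psi> \<alpha> \<beta>" and "\<gamma> \<noteq> []"
  shows "set \<beta> \<subseteq> set \<gamma>"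
proof (rule ccontr)
  assume "\<not> set \<beta> \<subseteq> set \<gamma>"
  then obtain b where b: "b \<in> set \<beta>" "b \<notin> set \<gamma>" by auto
  note hom = unital_star_homD[OF \<phi>]
  obtain X Y where XY: "\<And>m. \<phi> (gen_word S \<alpha>) ^ Suc m = X * gen_word S \<gamma> ^ m * Y"
    using tr(1) unfolding tracks_def by blast
  obtain X' Y' where X'Y': "\<And>m. \<psi> (gen_word S \<alpha>) ^ Suc m = X' * gen_word S \<beta> ^ m * Y'"
    using tr(2) unfolding tracks_def by blast
  have "star (gen_word S \<eta>) * gen_word S \<eta> = 1" for \<eta>
  proof (induction \<eta>)
    case (Cons k \<eta>)
    have "star (gen_word S (k # \<eta>)) * gen_word S (k # \<eta>)
        = star (gen_word S \<eta>) * (star (S k) * (S k * gen_word S \<eta>))"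
      by (simp add: star_mult mult.assoc)
    with Cons show ?case by (simp add: star_mult_gen_mult)
  qed simp
  then have iso: "star (\<phi> (gen_word S \<alpha>)) * \<phi> (gen_word S \<alpha>) = 1"
    by (metis hom(3,4,5))
  have iso_pow: "star (\<phi> (gen_word S \<alpha>) ^ m) * \<phi> (gen_word S \<alpha>) ^ m = 1" for m
  proof (induction m)
    case (Suc m)
    have "star (\<phi> (gen_word S \<alpha>) ^ Suc m) * \<phi> (gen_word S \<alpha>) ^ Suc m
      = star (\<phi> (gen_word S \<alpha>) ^ m) * (star (\<phi> (gen_word S \<alpha>)) * \<phi> (gen_word S \<alpha>)) * \<phi> (gen_word S \<alpha>) ^ m"
      by (simp add: star_mult mult.assoc)
    with Suc show ?case by (simp add: iso)
  qed simp
  have inter: "\<phi> (gen_word S \<alpha>) ^ m * w = w * \<psi> (gen_word S \<alpha>) ^ m" for m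
  proof (induction m)
    case (Suc m)
    have "\<phi> (gen_word S \<alpha>) ^ Suc m * w = \<phi> (gen_word S \<alpha>) * (w * \<psi> (gen_word S \<alpha>) ^ m)"
      by (simp add: mult.assoc Suc)
    also have "\<dots> = (w * \<psi> (gen_word S \<alpha>)) * \<psi> (gen_word S \<alpha>) ^ m"
      by (simp only: w(2) flip: mult.assoc)
    finally show ?case by (simp add: mult.assoc)
  qed simp
  \<comment> \<open>Powers of \<open>\<phi> (gen_word S \<alpha>)\<close> are isometries, so
    \<open>w\<close> may be multiplied by such a power and then by its adjoint; moving
    \<open>w\<close> past the power brings in \<open>\<psi>\<close>.\<close>
  have "w = star Y * (star (gen_word S \<gamma> ^ m) * (star X * w * X') * gen_word S \<beta> ^ m) * Y'" for m
  proof -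
    have "w = star (\<phi> (gen_word S \<alpha>) ^ Suc m) * (\<phi> (gen_word S \<alpha>) ^ Suc m * w)"
      using iso_pow[of "Suc m"] by (simp only: mult_1_left flip: mult.assoc)
    also have "\<dots> = star (X * gen_word S \<gamma> ^ m * Y) * (w * (X' * gen_word S \<beta> ^ m * Y'))"
      unfolding inter unfolding XY X'Y' ..
    finally show ?thesis by (simp add: star_mult mult.assoc)
  qed
  moreover have "(\<lambda>m. star Y * (star (gen_word S \<gamma> ^ m) * (star X * w * X') * gen_word S \<beta> ^ m) * Y')
      \<longlonglongrightarrow> star Y * 0 * Y'"
    using star_power_mult_tendsto_0[OF b \<open>\<gamma> \<noteq> []\<close>] by (intro tendsto_intros)
  ultimately have "(\<lambda>m::nat. w) \<longlonglongrightarrow> 0" by simp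
  then show False using w(1) by (simp add: LIMSEQ_const_iff)
qed

end

section \<open>The automorphisms generating the groups\<close>

text \<open>For \<open>p\<close>, \<open>q\<close> fixing \<open>i\<close>, this puts both row
  families into one: \<open>R_perms i\<close> is the case \<open>q = id\<close>,
  \<open>R_check_perms i\<close> the case \<open>p = id\<close>.\<close>

definition row_perm :: "'n \<Rightarrow> ('n \<Rightarrow> 'n) \<Rightarrow> ('n \<Rightarrow> 'n) \<Rightarrow> 'n \<times> 'n \<Rightarrow> 'n \<times> 'n" where
  "row_perm i p q = (\<lambda>(k, j). (k, if k = i then p j else q j))"

definition col_perm :: "'n \<Rightarrow> ('n \<Rightarrow> 'n) \<Rightarrow> ('n \<Rightarrow> 'n) \<Rightarrow> 'n \<times> 'n \<Rightarrow> 'n \<times> 'n" where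
  "col_perm i p q = (\<lambda>(k, j). (if j = i then p k else q k, j))"

lemma bij_row_perm:
  assumes "bij p" "bij q"
  shows "bij (row_perm i p q)"
proof (rule o_bij)
  show "row_perm i (inv' p) (inv' q) \<circ> row_perm i p q = id"
    using assms by (auto simp: row_perm_def fun_eq_iff bij_is_inj)
  show "row_perm i p q \<circ> row_perm i (inv' p) (inv' q) = id"
    using assms by (auto simp: row_perm_def fun_eq_iff bij_is_surj surj_f_inv_f)
qed

lemma col_perm_eq_swap: "col_perm i p q = prod.swap \<circ> row_perm i p q \<circ> prod.swap"
  by (auto simp: row_perm_def col_perm_def fun_eq_iff)

lemma bij_col_perm: "bij p \<Longrightarrow> bij q \<Longrightarrow> bij (col_perm i p q)"
  unfolding col_perm_eq_swap by (intro bij_comp bij_row_perm bij_swap)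

lemma permutes_fixes: "p permutes (UNIV - {i}) \<Longrightarrow> p i = i"
  by (simp add: permutes_def)

lemma permutes_fixes_iff: "p permutes (UNIV - {i}) \<Longrightarrow> p k = i \<longleftrightarrow> k = i"
  by (metis permutes_fixes permutes_inj injD)

lemma R_perms_eq: "R_perms (i::'n::finite) = (\<lambda>p. row_perm i p id) ` {p. p permutes (UNIV - {i})}"
proof (intro subset_antisym subsetI)
  fix u :: "'n \<times> 'n \<Rightarrow> 'n \<times> 'n" assume u: "u \<in> R_perms i"
  then have fix_u: "u (k, j) = (k, j)" if "k \<noteq> i \<or> j = i" for k j
    using that by (simp add: R_perms_def)
  have inj: "u x = u y \<longleftrightarrow> x = y" for x y
    using u by (auto simp: R_perms_def dest: permutes_inj injD)
  define p where "p j = snd (u (i, j))" for j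
  \<comment> \<open>A point of row \<open>i\<close> cannot leave it: its image would be a fixed
    point of \<open>u\<close>, contradicting injectivity.\<close>
  have up: "u (i, j) = (i, p j)" for j
  proof (rule ccontr)
    assume "u (i, j) \<noteq> (i, p j)"
    then have ne: "fst (u (i, j)) \<noteq> i" by (simp add: p_def prod_eq_iff)
    then have "u (u (i, j)) = u (i, j)"
      using fix_u[of "fst (u (i, j))" "snd (u (i, j))"] by simp
    with ne show False by (simp add: inj)
  qed
  have "inj p" using inj[of "(i, _)" "(i, _)"] by (auto simp: up inj_def)
  then have "bij p" by (simp add: bij_def finite_UNIV_inj_surj)
  moreover have "p i = i" using fix_u[of i i] by (simp add: p_def)
  ultimately have "p permutes (UNIV - {i})"
    by (auto simp: permutes_def bij_iff)
  moreover have "u = row_perm i p id"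
    using fix_u up by (auto simp: row_perm_def fun_eq_iff)
  ultimately show "u \<in> (\<lambda>p. row_perm i p id) ` {p. p permutes (UNIV - {i})}"
    by blast
next
  fix u :: "'n \<times> 'n \<Rightarrow> 'n \<times> 'n" assume "u \<in> (\<lambda>p. row_perm i p id) ` {p. p permutes (UNIV - {i})}"
  then obtain p where p: "p permutes (UNIV - {i})" "u = row_perm i p id" by blast
  have "bij u" using p bij_row_perm[of p id i] permutes_bij by auto
  then have "u permutes UNIV" by (rule bij_imp_permutes) simp
  then show "u \<in> R_perms i"
    using p permutes_fixes by (auto simp: R_perms_def row_perm_def)
qed

lemma R_check_perms_eq: "R_check_perms i = row_perm i id ` {q. q permutes (UNIV - {i})}"
proof (intro subset_antisym subsetI)
  fix u assume "u \<in> R_check_perms i"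
  then obtain q where q: "q permutes (UNIV - {i})"
    "\<And>k j. k \<noteq> i \<Longrightarrow> j \<noteq> i \<Longrightarrow> u (k, j) = (k, q j)" "\<And>k j. k = i \<or> j = i \<Longrightarrow> u (k, j) = (k, j)"
    unfolding R_check_perms_def by blast
  \<comment> \<open>In column \<open>i\<close> the point is fixed by \<open>u\<close>, which agrees
    with \<open>q\<close> because \<open>q i = i\<close>.\<close>
  have "u (k, j) = row_perm i id q (k, j)" for k j
    using permutes_fixes[OF q(1)] q(2,3) by (cases "j = i") (auto simp: row_perm_def)
  then have "u = row_perm i id q" by auto
  with q(1) show "u \<in> row_perm i id ` {q. q permutes (UNIV - {i})}" by blast
next
  fix u assume "u \<in> row_perm i id ` {q. q permutes (UNIV - {i})}"
  then obtain q where q: "q permutes (UNIV - {i})" "u = row_perm i id q" by blast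
  have "bij u" using q bij_row_perm[of id q i] permutes_bij by auto
  then have "u permutes UNIV" by (rule bij_imp_permutes) simp
  then show "u \<in> R_check_perms i"
    using q permutes_fixes[OF q(1)] by (auto simp: R_check_perms_def row_perm_def intro!: exI[of _ q])
qed

lemma permutes_UNIV_swap:
  fixes u :: "'n \<times> 'n \<Rightarrow> 'n \<times> 'n"
  shows "prod.swap \<circ> u \<circ> prod.swap permutes UNIV \<longleftrightarrow> u permutes UNIV"
proof -
  have *: "prod.swap \<circ> u \<circ> prod.swap permutes UNIV" if "u permutes UNIV" for u :: "'n \<times> 'n \<Rightarrow> 'n \<times> 'n"
    using permutes_bij[OF that] by (intro bij_imp_permutes bij_comp bij_swap) auto
  show ?thesis using *[of u] *[of "prod.swap \<circ> u \<circ> prod.swap"] by (auto simp: comp_def)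
qed

text \<open>With \<open>T\<close> the conjugation by the coordinate swap, this carries the
  description of the row families over to the columns.\<close>

lemma involution_image_eq:
  assumes "\<And>u. u \<in> A \<longleftrightarrow> T u \<in> B" "\<And>u. T (T u) = u"
  shows "A = T ` B"
  using assms by (auto simp: image_iff) metis

lemma C_perms_eq: "C_perms (i::'n::finite) = (\<lambda>p. col_perm i p id) ` {p. p permutes (UNIV - {i})}"
proof -
  have "u \<in> C_perms i \<longleftrightarrow> prod.swap \<circ> u \<circ> prod.swap \<in> R_perms i" for u
    by (auto simp: C_perms_def R_perms_def permutes_UNIV_swap prod.swap_def prod_eq_iff)
  then have "C_perms i = (\<lambda>u. prod.swap \<circ> u \<circ> prod.swap) ` R_perms i"
    by (rule involution_image_eq) (simp add: fun_eq_iff)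
  then show ?thesis by (simp add: R_perms_eq col_perm_eq_swap image_image)
qed

lemma C_check_perms_eq: "C_check_perms i = col_perm i id ` {q. q permutes (UNIV - {i})}"
proof -
  have "u \<in> C_check_perms i \<longleftrightarrow> prod.swap \<circ> u \<circ> prod.swap \<in> R_check_perms i" for u
    unfolding C_check_perms_def R_check_perms_def permutes_UNIV_swap mem_Collect_eq
    by (intro conj_cong refl ex_cong1) (auto simp: prod.swap_def prod_eq_iff)
  then have "C_check_perms i = (\<lambda>u. prod.swap \<circ> u \<circ> prod.swap) ` R_check_perms i"
    by (rule involution_image_eq) (simp add: fun_eq_iff)
  then show ?thesis by (simp add: R_check_perms_eq col_perm_eq_swap image_image)
qed

text \<open>Isometries with orthogonal ranges summing to 1 behave like an orthonormal basis that
  \<open>U u\<close> permutes. This serves both for single generators and for words of length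
  two.\<close>

lemma orthonormal_family_unitary:
  fixes W :: "'m::finite \<Rightarrow> 'a::cstar_algebra"
  assumes orth: "\<And>\<alpha> \<beta>. star (W \<alpha>) * W \<beta> = (if \<alpha> = \<beta> then 1 else 0)"
    and sum1: "(\<Sum>\<alpha>\<in>UNIV. W \<alpha> * star (W \<alpha>)) = 1"
  defines "U \<equiv> \<lambda>u. \<Sum>\<alpha>\<in>UNIV. W (u \<alpha>) * star (W \<alpha>)"
  shows "U u * W \<beta> = W (u \<beta>)" and "bij u \<Longrightarrow> unitary (U u)"
proof -
  show U: "U u * W \<beta> = W (u \<beta>)" for \<beta>
    by (simp add: U_def sum_distrib_right mult.assoc orth if_distrib cong: if_cong)
  assume u: "bij u"
  have star_U: "star (U u) = (\<Sum>\<alpha>\<in>UNIV. W \<alpha> * star (W (u \<alpha>)))"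
    by (simp add: U_def star_sum star_mult star_star)
  have star_U_mult: "star (U u) * W (u \<beta>) = W \<beta>" for \<beta>
    using bij_is_inj[OF u]
    by (simp add: star_U sum_distrib_right mult.assoc orth inj_eq if_distrib cong: if_cong)
  have "star (U u) * U u = (\<Sum>\<beta>\<in>UNIV. star (U u) * W (u \<beta>) * star (W \<beta>))"
    unfolding U_def by (simp add: sum_distrib_left mult.assoc)
  also have "\<dots> = 1" by (simp add: star_U_mult sum1)
  finally have 1: "star (U u) * U u = 1" .
  have "U u * star (U u) = (\<Sum>\<beta>\<in>UNIV. U u * W \<beta> * star (W (u \<beta>)))"
    unfolding star_U by (simp add: sum_distrib_left mult.assoc)
  also have "\<dots> = (\<Sum>\<beta>\<in>UNIV. W (u \<beta>) * star (W (u \<beta>)))" by (simp add: U)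
  also have "\<dots> = 1"
    using sum.reindex_bij_betw[OF u, of "\<lambda>\<alpha>. W \<alpha> * star (W \<alpha>)"] sum1 by simp
  finally show "unitary (U u)" using 1 by (simp add: unitary_def)
qed

section \<open>Permutation unitaries, composition laws and the action on periodic words\<close>

context cuntz_generators
begin

lemma sum_gen_mult: "x = (\<Sum>j\<in>UNIV. x * S j * star (S j))"
  by (simp add: mult.assoc sum_gen flip: sum_distrib_left)

text \<open>As the ranges of the generators sum to 1, identities between elements can be checked
  letter by letter.\<close>

lemma gen_ext: "(\<And>j. x * S j = y * S j) \<Longrightarrow> x = y"
  using sum_gen_mult[of x] sum_gen_mult[of y] by simp

text \<open>For bijective \<open>p\<close>, the unitary of a permutation of words of length
  one.\<close>

definition V :: "('n \<Rightarrow> 'n) \<Rightarrow> 'a" where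
  "V p = (\<Sum>j\<in>UNIV. S (p j) * star (S j))"

lemma V_mult_gen: "V p * S j = S (p j)"
  unfolding V_def by (rule orthonormal_family_unitary(1)[where W = S]) (simp_all add: star_mult_gen sum_gen)

lemma V_comp: "V (p \<circ> q) = V p * V q"
  by (rule gen_ext) (simp add: V_mult_gen mult.assoc)

lemma V_id [simp]: "V id = 1"
  by (simp add: V_def sum_gen)

lemma unitary_V: "bij p \<Longrightarrow> unitary (V p)"
  unfolding V_def by (rule orthonormal_family_unitary(2)[where W = S]) (simp_all add: star_mult_gen sum_gen)

lemma star_V_mult_gen: "bij p \<Longrightarrow> star (V p) * S (p j) = S j"
  using unitary_V[of p] by (metis V_mult_gen mult.assoc mult_1_left unitary_def)

lemma perm_unitary_eq:
  "perm_unitary S u = (let W = \<lambda>\<alpha>. S (fst \<alpha>) * S (snd \<alpha>) in \<Sum>\<alpha>\<in>UNIV. W (u \<alpha>) * star (W \<alpha>))"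
  by (simp add: perm_unitary_def Let_def case_prod_unfold)

lemma
  shows perm_unitary_mult_gen:
      "perm_unitary S u * (S k * S j) = S (fst (u (k, j))) * S (snd (u (k, j)))"
    and unitary_perm_unitary: "bij u \<Longrightarrow> unitary (perm_unitary S u)"
proof -
  define W where "W \<alpha> = S (fst \<alpha>) * S (snd \<alpha>)" for \<alpha>
  have orth: "star (W \<alpha>) * W \<beta> = (if \<alpha> = \<beta> then 1 else 0)" for \<alpha> \<beta>
    by (auto simp: W_def star_mult mult.assoc star_mult_gen_mult star_mult_gen prod_eq_iff)
  have "(\<Sum>\<alpha>\<in>UNIV. W \<alpha> * star (W \<alpha>)) = (\<Sum>k\<in>UNIV. \<Sum>j\<in>UNIV. S k * (S j * star (S j)) * star (S k))"
    by (simp add: W_def star_mult mult.assoc sum.cartesian_product case_prod_unfold)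
  also have "\<dots> = 1"
    by (simp add: sum_gen flip: sum_distrib_left sum_distrib_right)
  finally have sum1: "(\<Sum>\<alpha>\<in>UNIV. W \<alpha> * star (W \<alpha>)) = 1" .
  have U: "perm_unitary S u = (\<Sum>\<alpha>\<in>UNIV. W (u \<alpha>) * star (W \<alpha>))" for u
    by (simp add: perm_unitary_eq W_def)
  show "perm_unitary S u * (S k * S j) = S (fst (u (k, j))) * S (snd (u (k, j)))"
    unfolding U using orthonormal_family_unitary(1)[OF orth sum1, of u "(k, j)"] by (simp add: W_def)
  show "bij u \<Longrightarrow> unitary (perm_unitary S u)"
    unfolding U by (rule orthonormal_family_unitary(2)[OF orth sum1])
qed

lemma
  assumes "bij u"
  shows hom_perm_endo: "unital_star_hom (perm_endo S u)"
    and perm_endo_gen: "perm_endo S u (S k) = perm_unitary S u * S k"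
  using cuntz_endo_works[OF is_cuntz unitary_perm_unitary[OF assms]] by (simp_all add: perm_endo_def)

text \<open>This is uniqueness in the universal property, for the Cuntz family formed by the images
  of the generators.\<close>

lemma hom_eqI:
  assumes \<phi>: "unital_star_hom \<phi>" and \<psi>: "unital_star_hom \<psi>" and eq: "\<And>k. \<phi> (S k) = \<psi> (S k)"
  shows "\<phi> = (\<psi> :: 'a \<Rightarrow> 'b::cstar_algebra)"
proof -
  note hom = unital_star_homD[OF \<phi>]
  interpret linear \<phi> by (rule unital_star_hom_linear[OF \<phi>])
  have "cuntz_family (\<lambda>k. \<phi> (S k))"
    using family unfolding cuntz_family_def by (simp flip: hom sum)
  from cuntz_algebra_universal[OF is_cuntz this] show ?thesis
    using \<phi> \<psi> eq by auto
qed

lemma perm_endo_row: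
  assumes "bij p" "bij q"
  shows "perm_endo S (row_perm i p q) (S k) = S k * V (if k = i then p else q)"
  unfolding perm_endo_gen[OF bij_row_perm[OF assms]]
  by (rule gen_ext) (simp add: mult.assoc perm_unitary_mult_gen V_mult_gen row_perm_def)

text \<open>With \<open>P = S i * star (S i)\<close> the value is
  \<open>S (p k) * P + S (q k) * (1 - P)\<close>: the projection tests whether the next letter is
  \<open>i\<close>.\<close>

lemma perm_endo_col:
  assumes "bij p" "bij q"
  shows "perm_endo S (col_perm i p q) (S k) = S (q k) + (S (p k) - S (q k)) * (S i * star (S i))"
  unfolding perm_endo_gen[OF bij_col_perm[OF assms]]
  by (rule gen_ext)
    (simp add: mult.assoc perm_unitary_mult_gen star_mult_gen col_perm_def distrib_right left_diff_distrib)

text \<open>In the image of \<open>S (r j) * star (S j)\<close> the twists after the two generators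
  agree, since \<open>c (r j) = c j\<close>, so they cancel.\<close>

lemma hom_V_eq:
  assumes \<phi>: "unital_star_hom \<phi>" and gen: "\<And>k. \<phi> (S k) = S k * V (c k)"
    and bij: "\<And>k. bij (c k)" and c: "\<And>k. c (r k) = c k"
  shows "\<phi> (V r) = V r"
proof -
  note hom = unital_star_homD[OF \<phi>]
  interpret linear \<phi> by (rule unital_star_hom_linear[OF \<phi>])
  have "\<phi> (S (r j) * star (S j)) = S (r j) * (V (c j) * star (V (c j))) * star (S j)" for j
    by (simp add: hom gen c star_mult mult.assoc)
  also have "\<dots> j = S (r j) * star (S j)" for j
    using unitary_V[OF bij] by (simp add: unitary_def)
  finally show ?thesis by (simp add: V_def sum)
qed

lemma row_comp:
  assumes p: "p permutes (UNIV - {i})" "p' permutes (UNIV - {i})"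
    and q: "q permutes (UNIV - {i})" "q' permutes (UNIV - {i})"
  shows "perm_endo S (row_perm i p q) \<circ> perm_endo S (row_perm i p' q')
    = perm_endo S (row_perm i (p \<circ> p') (q \<circ> q'))"
    (is "?\<phi> \<circ> ?\<psi> = ?\<theta>")
proof (rule hom_eqI)
  note bij = p[THEN permutes_bij] q[THEN permutes_bij]
  have \<phi>: "unital_star_hom ?\<phi>" and \<psi>: "unital_star_hom ?\<psi>"
    by (intro hom_perm_endo bij_row_perm bij)+
  show "unital_star_hom (?\<phi> \<circ> ?\<psi>)"
    using \<phi> \<psi> by (simp add: unital_star_hom_def)
  show "unital_star_hom ?\<theta>"
    by (intro hom_perm_endo bij_row_perm bij_comp bij)
  \<comment> \<open>The twist depends only on whether the letter is \<open>i\<close>, and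
    \<open>r\<close> preserves this distinction.\<close>
  have V: "?\<phi> (V r) = V r" if "r permutes (UNIV - {i})" for r
    by (rule hom_V_eq[OF \<phi> perm_endo_row[OF bij(1,3)]])
      (simp_all add: bij permutes_fixes_iff[OF that])
  show "(?\<phi> \<circ> ?\<psi>) (S k) = ?\<theta> (S k)" for k
    by (simp add: perm_endo_row bij bij_comp unital_star_homD(3)[OF \<phi>] V p q V_comp mult.assoc)
qed

lemma row_id: "perm_endo S (row_perm i id id) = id"
proof (rule hom_eqI)
  show "unital_star_hom (perm_endo S (row_perm i id id))"
    by (intro hom_perm_endo bij_row_perm bij_id)
  show "unital_star_hom (id :: 'a \<Rightarrow> 'a)" by (simp add: unital_star_hom_def)
qed (simp add: perm_endo_row)

lemma col_comp:
  assumes p: "p permutes (UNIV - {i})" "p' permutes (UNIV - {i})"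
    and q: "q permutes (UNIV - {i})" "q' permutes (UNIV - {i})"
  shows "perm_endo S (col_perm i p q) \<circ> perm_endo S (col_perm i p' q')
    = perm_endo S (col_perm i (p \<circ> p') (q \<circ> q'))"
    (is "?\<phi> \<circ> ?\<psi> = ?\<theta>")
proof (rule hom_eqI)
  note bij = p[THEN permutes_bij] q[THEN permutes_bij]
  have \<phi>: "unital_star_hom ?\<phi>" and \<psi>: "unital_star_hom ?\<psi>"
    by (intro hom_perm_endo bij_col_perm bij)+
  note hom = unital_star_homD[OF \<phi>]
  interpret linear ?\<phi> by (rule unital_star_hom_linear[OF \<phi>])
  show "unital_star_hom (?\<phi> \<circ> ?\<psi>)"
    using \<phi> \<psi> by (simp add: unital_star_hom_def)
  show "unital_star_hom ?\<theta>"
    by (intro hom_perm_endo bij_col_perm bij_comp bij)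
  \<comment> \<open>As \<open>S i\<close> is fixed, so is the projection
    \<open>S i * star (S i)\<close>; its idempotence then keeps the \<open>p\<close> and
    \<open>q\<close> parts of the composite apart.\<close>
  have i: "?\<phi> (S i) = S i"
    by (simp add: perm_endo_col bij permutes_fixes[OF p(1)] permutes_fixes[OF q(1)])
  show "(?\<phi> \<circ> ?\<psi>) (S k) = ?\<theta> (S k)" for k
    by (simp add: perm_endo_col[of p' q'] bij bij_comp hom i add diff)
      (simp add: perm_endo_col bij bij_comp algebra_simps star_mult_gen_mult)
qed

lemma col_id: "perm_endo S (col_perm i id id) = id"
proof (rule hom_eqI)
  show "unital_star_hom (perm_endo S (col_perm i id id))"
    by (intro hom_perm_endo bij_col_perm bij_id)
  show "unital_star_hom (id :: 'a \<Rightarrow> 'a)" by (simp add: unital_star_hom_def)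
qed (simp add: perm_endo_col)

text \<open>The twist left by a letter acts on the next one: a letter following \<open>i\<close> is
  moved by \<open>p\<close>, any other by \<open>q\<close>, with the period read cyclically. The
  twist of the last letter passes to the next period, so the image is a conjugate by
  \<open>V p\<close> or \<open>V q\<close>.\<close>

lemma
  assumes p: "p permutes (UNIV - {i})" and q: "q permutes (UNIV - {i})"
  shows row_tracks_center: "tracks (perm_endo S (row_perm i p q)) [i] [i]"
    and row_tracks_single: "k \<noteq> i \<Longrightarrow> tracks (perm_endo S (row_perm i p q)) [k] [q k]"
    and row_tracks_pair: "a \<noteq> i \<Longrightarrow> tracks (perm_endo S (row_perm i p q)) [i, a] [i, p a]"
    and row_tracks_triple: "a \<noteq> i \<Longrightarrow> b \<noteq> i \<Longrightarrow>
      tracks (perm_endo S (row_perm i p q)) [i, a, b] [i, p a, q b]"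
proof -
  note bij = p[THEN permutes_bij] q[THEN permutes_bij]
  have \<phi>: "unital_star_hom (perm_endo S (row_perm i p q))"
    by (intro hom_perm_endo bij_row_perm bij)
  note gen = perm_endo_row[OF bij] unital_star_homD(3)[OF \<phi>]
  have V: "V r * (S j * x) = S (r j) * x" for r j x
    by (simp add: V_mult_gen flip: mult.assoc)
  have star_V: "star (V r) * (S (r j) * x) = S j * x" if "bij r" for r j x
    using that by (simp add: star_V_mult_gen flip: mult.assoc)
  have unit: "V r * star (V r) = 1" if "bij r" for r
    using unitary_V[OF that] by (simp add: unitary_def)
  show "tracks (perm_endo S (row_perm i p q)) [i] [i]"
    using star_V[OF bij(1), of i] permutes_fixes[OF p]
    by (intro tracks_similar[where X = "star (V p)" and Y = "V p"])
      (simp_all add: gen unit bij mult.assoc)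
  show "tracks (perm_endo S (row_perm i p q)) [k] [q k]" if "k \<noteq> i"
    using that by (intro tracks_similar[where X = "star (V q)" and Y = "V q"])
      (simp_all add: gen unit bij mult.assoc star_V)
  show "tracks (perm_endo S (row_perm i p q)) [i, a] [i, p a]" if "a \<noteq> i"
    using that star_V[OF bij(2), of i] permutes_fixes[OF q]
    by (intro tracks_similar[where X = "star (V q)" and Y = "V q"])
      (simp_all add: gen unit bij mult.assoc V)
  show "tracks (perm_endo S (row_perm i p q)) [i, a, b] [i, p a, q b]" if "a \<noteq> i" "b \<noteq> i"
    using that star_V[OF bij(2), of i] permutes_fixes[OF q]
    by (intro tracks_similar[where X = "star (V q)" and Y = "V q"])
      (simp_all add: gen unit bij mult.assoc V)
qed

text \<open>Here a letter is moved according to its successor: by \<open>p\<close> if that is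
  \<open>i\<close>, otherwise by \<open>q\<close>. The image of the last letter is undetermined
  until another period follows, hence the use of \<open>tracks_shift\<close>. Compared with the
  rows, \<open>p\<close> and \<open>q\<close> change places on the triples.\<close>

lemma
  assumes p: "p permutes (UNIV - {i})" and q: "q permutes (UNIV - {i})"
  shows col_tracks_center: "tracks (perm_endo S (col_perm i p q)) [i] [i]"
    and col_tracks_single: "k \<noteq> i \<Longrightarrow> tracks (perm_endo S (col_perm i p q)) [k] [q k]"
    and col_tracks_pair: "a \<noteq> i \<Longrightarrow> tracks (perm_endo S (col_perm i p q)) [i, a] [i, p a]"
    and col_tracks_triple: "a \<noteq> i \<Longrightarrow> b \<noteq> i \<Longrightarrow>
      tracks (perm_endo S (col_perm i p q)) [i, a, b] [i, q a, p b]"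
proof -
  note bij = p[THEN permutes_bij] q[THEN permutes_bij]
  have \<phi>: "unital_star_hom (perm_endo S (col_perm i p q))"
    by (intro hom_perm_endo bij_col_perm bij)
  note gen = perm_endo_col[OF bij] unital_star_homD(3)[OF \<phi>]
  note fix_i = permutes_fixes[OF p] permutes_fixes[OF q] permutes_fixes_iff[OF p] permutes_fixes_iff[OF q]
  have [simp]: "r k = i \<longleftrightarrow> k = i" "i = r k \<longleftrightarrow> k = i" if "r = p \<or> r = q" for r k
    using that fix_i by metis+
  note simps = gen fix_i star_mult_gen_mult star_mult_gen algebra_simps
  show "tracks (perm_endo S (col_perm i p q)) [i] [i]"
    by (rule tracks_shift) (simp add: simps)
  show "tracks (perm_endo S (col_perm i p q)) [k] [q k]" if "k \<noteq> i"
    using that by (intro tracks_shift) (simp add: simps)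
  show "tracks (perm_endo S (col_perm i p q)) [i, a] [i, p a]" if "a \<noteq> i"
    using that by (intro tracks_shift) (simp add: simps)
  show "tracks (perm_endo S (col_perm i p q)) [i, a, b] [i, q a, p b]" if "a \<noteq> i" "b \<noteq> i"
    using that by (intro tracks_shift) (simp add: simps)
qed

end

section \<open>The group structure\<close>

lemma group_cstar_aut: "group (cstar_aut :: ('a::cstar_algebra \<Rightarrow> 'a) monoid)"
proof (rule groupI)
  fix \<phi> :: "'a \<Rightarrow> 'a" assume "\<phi> \<in> carrier cstar_aut"
  then have \<phi>: "unital_star_hom \<phi>" "bij \<phi>" by (simp_all add: cstar_aut_def)
  have r: "\<phi> (inv' \<phi> x) = x" and l: "inv' \<phi> (\<phi> x) = x" for x
    using \<phi>(2) by (simp_all add: bij_is_surj surj_f_inv_f bij_is_inj)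
  have "unital_star_hom (inv' \<phi>)"
    unfolding unital_star_hom_def using unital_star_homD[OF \<phi>(1)] r l
    by (metis (no_types, lifting))
  with \<phi> l show "\<exists>\<psi>\<in>carrier cstar_aut. \<psi> \<otimes>\<^bsub>cstar_aut\<^esub> \<phi> = \<one>\<^bsub>cstar_aut\<^esub>"
    by (auto simp: cstar_aut_def bij_imp_bij_inv fun_eq_iff intro!: bexI[of _ "inv' \<phi>"] exI[of _ "inv' \<phi>"])
qed (auto simp: cstar_aut_def unital_star_hom_def bij_comp)

text \<open>Equal classes mean that \<phi> is \<psi> followed by conjugation with a unitary, which
  becomes a nonzero intertwiner.\<close>

lemma out_proj_eqD:
  assumes "out_proj \<phi> = out_proj (\<psi> :: 'a::cstar_algebra \<Rightarrow> 'a)"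
  obtains w where "w \<noteq> 0" "\<And>x. \<phi> x * w = w * \<psi> x"
proof -
  have "id \<in> (inner_auts :: ('a \<Rightarrow> 'a) set)"
    by (auto simp: inner_auts_def unitary_def fun_eq_iff intro!: exI[of _ 1])
  then have "\<phi> \<in> out_proj \<phi>"
    by (auto simp: out_proj_def r_coset_def cstar_aut_def intro!: bexI[of _ id])
  then obtain w where w: "unitary w" "\<phi> = (\<lambda>x. w * x * star w) \<circ> \<psi>"
    unfolding assms by (auto simp: out_proj_def r_coset_def cstar_aut_def inner_auts_def)
  have "\<phi> x * w = w * \<psi> x * (star w * w)" for x by (simp add: w(2) mult.assoc)
  with w(1) have "\<phi> x * w = w * \<psi> x" for x by (simp add: unitary_def)
  moreover have "w \<noteq> 0" using w(1) by (auto simp: unitary_def)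
  ultimately show ?thesis using that by blast
qed

lemma out_proj_id: "out_proj id = inner_auts"
  by (auto simp: out_proj_def r_coset_def cstar_aut_def)

lemma group_DirProd_sym_group: "group (sym_group m \<times>\<times> sym_group m)"
  by (intro DirProd_group sym_group_is_group)

text \<open>Conjugation by \<open>f\<close>, extended by the identity outside \<open>B\<close>. It
  identifies the permutations of the index set of \<open>sym_group\<close> with those of
  \<open>UNIV - {i}\<close>.\<close>

definition transport_perm :: "('b \<Rightarrow> 'c) \<Rightarrow> 'b set \<Rightarrow> 'c set \<Rightarrow> ('b \<Rightarrow> 'b) \<Rightarrow> 'c \<Rightarrow> 'c" where
  "transport_perm f A B p = (\<lambda>x. if x \<in> B then f (p (inv_into A f x)) else x)"

lemma transport_perm_bij:
  "bij_betw f A B \<Longrightarrow> bij_betw (transport_perm f A B) {p. p permutes A} {p. p permutes B}"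
  unfolding transport_perm_def by (rule bij_betw_permutations)

lemma transport_perm_comp:
  assumes f: "bij_betw f A B" and "p' permutes A"
  shows "transport_perm f A B (p \<circ> p') = transport_perm f A B p \<circ> transport_perm f A B p'"
proof
  fix x
  have "p' (inv_into A f x) \<in> A" if "x \<in> B"
    using that f permutes_in_image[OF assms(2)] by (metis bij_betw_def inv_into_into)
  then show "transport_perm f A B (p \<circ> p') x = (transport_perm f A B p \<circ> transport_perm f A B p') x"
    using f by (auto simp: transport_perm_def bij_betw_inv_into_left bij_betwE)
qed

text \<open>The common features of the row and column families, from which the subgroup property,
  the isomorphism type and the trivial kernel follow at once for both.\<close>

locale twisted_action = cuntz_generators S for S :: "'n::finite \<Rightarrow> 'a::cstar_algebra" +
  fixes i :: 'n and F :: "('n \<Rightarrow> 'n) \<Rightarrow> ('n \<Rightarrow> 'n) \<Rightarrow> 'a \<Rightarrow> 'a"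
  assumes F_hom: "p permutes (UNIV - {i}) \<Longrightarrow> q permutes (UNIV - {i}) \<Longrightarrow> unital_star_hom (F p q)"
    and F_comp: "p permutes (UNIV - {i}) \<Longrightarrow> p' permutes (UNIV - {i}) \<Longrightarrow>
      q permutes (UNIV - {i}) \<Longrightarrow> q' permutes (UNIV - {i}) \<Longrightarrow>
      F p q \<circ> F p' q' = F (p \<circ> p') (q \<circ> q')"
    and F_id: "F id id = id"
    and F_tracks_single: "p permutes (UNIV - {i}) \<Longrightarrow> q permutes (UNIV - {i}) \<Longrightarrow>
      k \<noteq> i \<Longrightarrow> tracks (F p q) [k] [q k]"
    and F_tracks_pair: "p permutes (UNIV - {i}) \<Longrightarrow> q permutes (UNIV - {i}) \<Longrightarrow>
      a \<noteq> i \<Longrightarrow> tracks (F p q) [i, a] [i, p a]"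
begin

lemma F_in_carrier:
  assumes p: "p permutes (UNIV - {i})" and q: "q permutes (UNIV - {i})"
  shows "F p q \<in> carrier cstar_aut"
proof -
  have "F (inv' p) (inv' q) \<circ> F p q = id" "F p q \<circ> F (inv' p) (inv' q) = id"
    using p q by (simp_all add: F_comp permutes_inv permutes_inv_o F_id)
  then have "bij (F p q)" by (rule o_bij)
  then show ?thesis using F_hom[OF p q] by (simp add: cstar_aut_def)
qed

text \<open>The words \<open>kkk...\<close> reveal \<open>q\<close> and the words
  \<open>iaia...\<close> reveal \<open>p\<close>. The case \<open>w = 1\<close> gives injectivity of
  \<open>F\<close>, the general case triviality of the kernel in the outer automorphism
  group.\<close>

lemma intertwiner_imp_eq:
  assumes p: "p permutes (UNIV - {i})" "p' permutes (UNIV - {i})"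
    and q: "q permutes (UNIV - {i})" "q' permutes (UNIV - {i})"
    and w: "w \<noteq> 0" "\<And>x. F p q x * w = w * F p' q' x"
  shows "p = p' \<and> q = q'"
proof -
  note sub = intertwiner_tracks_subset[OF F_hom[OF p(1) q(1)] w]
  have "q k = q' k" for k
  proof (cases "k = i")
    case False
    from sub[OF F_tracks_single[OF p(1) q(1) False] F_tracks_single[OF p(2) q(2) False]]
    show ?thesis by simp
  qed (simp add: permutes_fixes[OF q(1)] permutes_fixes[OF q(2)])
  moreover have "p a = p' a" for a
  proof (cases "a = i")
    case False
    from sub[OF F_tracks_pair[OF p(1) q(1) False] F_tracks_pair[OF p(2) q(2) False]]
    show ?thesis using False permutes_fixes_iff[OF p(2)] by simp
  qed (simp add: permutes_fixes[OF p(1)] permutes_fixes[OF p(2)])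
  ultimately show ?thesis by blast
qed

lemma F_inj:
  assumes "p permutes (UNIV - {i})" "p' permutes (UNIV - {i})"
    and "q permutes (UNIV - {i})" "q' permutes (UNIV - {i})" and "F p q = F p' q'"
  shows "p = p' \<and> q = q'"
  using assms by (intro intertwiner_imp_eq[where w = 1]) auto

definition twists :: "('a \<Rightarrow> 'a) set" where
  "twists = {F p q | p q. p permutes (UNIV - {i}) \<and> q permutes (UNIV - {i})}"

lemma twistsI: "p permutes (UNIV - {i}) \<Longrightarrow> q permutes (UNIV - {i}) \<Longrightarrow> F p q \<in> twists"
  by (auto simp: twists_def)

lemma twistsE:
  assumes "\<phi> \<in> twists"
  obtains p q where "\<phi> = F p q" "p permutes (UNIV - {i})" "q permutes (UNIV - {i})"
  using assms by (auto simp: twists_def)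

text \<open>The maps \<open>F p q\<close> form a subgroup, and each factors as \<open>F p id\<close>
  composed with \<open>F id q\<close>.\<close>

lemma generate_eq_twists:
  "generate cstar_aut ((\<lambda>p. F p id) ` {p. p permutes (UNIV - {i})} \<union> F id ` {q. q permutes (UNIV - {i})})
    = twists" (is "generate _ ?G = _")
proof (rule subset_antisym)
  interpret group "cstar_aut :: ('a \<Rightarrow> 'a) monoid" by (rule group_cstar_aut)
  have "subgroup twists cstar_aut"
  proof (rule subgroupI)
    show "twists \<subseteq> carrier cstar_aut"
      by (auto simp: twists_def intro!: F_in_carrier)
    show "twists \<noteq> {}" unfolding twists_def using permutes_id by blast
    fix \<phi> \<psi> assume "\<phi> \<in> twists" "\<psi> \<in> twists"
    then show "\<phi> \<otimes>\<^bsub>cstar_aut\<^esub> \<psi> \<in> twists"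
      by (auto elim!: twistsE simp: cstar_aut_def F_comp intro!: twistsI permutes_compose)
  next
    fix \<phi> assume "\<phi> \<in> twists"
    then obtain p q where pq: "\<phi> = F p q" "p permutes (UNIV - {i})" "q permutes (UNIV - {i})"
      by (rule twistsE)
    have "F (inv' p) (inv' q) \<otimes>\<^bsub>cstar_aut\<^esub> F p q = \<one>\<^bsub>cstar_aut\<^esub>"
      using pq by (simp add: cstar_aut_def F_comp permutes_inv permutes_inv_o F_id)
    then have "m_inv cstar_aut \<phi> = F (inv' p) (inv' q)"
      unfolding pq(1) using pq by (intro inv_equality F_in_carrier permutes_inv)
    then show "m_inv cstar_aut \<phi> \<in> twists"
      using pq by (auto intro!: twistsI permutes_inv)
  qed
  then show "generate cstar_aut ?G \<subseteq> twists"
    by (intro generate_subgroup_incl) (auto intro: twistsI permutes_id)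
  show "twists \<subseteq> generate cstar_aut ?G"
  proof
    fix \<phi> assume "\<phi> \<in> twists"
    then obtain p q where pq: "\<phi> = F p q" "p permutes (UNIV - {i})" "q permutes (UNIV - {i})"
      by (rule twistsE)
    have "\<phi> = F p id \<otimes>\<^bsub>cstar_aut\<^esub> F id q"
      using pq by (simp add: cstar_aut_def F_comp permutes_id)
    also have "\<dots> \<in> generate cstar_aut ?G"
      using pq by (intro generate.eng generate.incl) auto
    finally show "\<phi> \<in> generate cstar_aut ?G" .
  qed
qed

lemma subgroup_twists: "subgroup twists cstar_aut"
  unfolding generate_eq_twists[symmetric]
  by (intro group.generate_is_subgroup group_cstar_aut) (auto intro!: F_in_carrier permutes_id)

lemma twists_iso:
  "cstar_aut\<lparr>carrier := twists\<rparr> \<cong> sym_group (CARD('n) - 1) \<times>\<times> sym_group (CARD('n) - 1)"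
proof -
  let ?A = "{1..CARD('n) - 1}" and ?B = "UNIV - {i}"
  have "card ?A = card ?B" by (simp add: card_Diff_subset)
  then obtain f where f: "bij_betw f ?A ?B"
    by (meson finite_same_card_bij finite_atLeastAtMost finite)
  define T where "T = transport_perm f ?A ?B"
  have T: "bij_betw T {p. p permutes ?A} {p. p permutes ?B}"
    unfolding T_def by (rule transport_perm_bij[OF f])
  then have T_perm: "T p permutes ?B" if "p permutes ?A" for p
    using that bij_betwE by fastforce
  have "(\<lambda>(p, q). F (T p) (T q)) \<in> iso (sym_group (CARD('n) - 1) \<times>\<times> sym_group (CARD('n) - 1))
      (cstar_aut\<lparr>carrier := twists\<rparr>)"
  proof (rule isoI)
    show "(\<lambda>(p, q). F (T p) (T q)) \<in> hom (sym_group (CARD('n) - 1) \<times>\<times> sym_group (CARD('n) - 1))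
      (cstar_aut\<lparr>carrier := twists\<rparr>)"
      by (rule homI) (auto simp: DirProd_def sym_group_def cstar_aut_def T_perm F_comp transport_perm_comp[OF f, folded T_def]
          intro!: twistsI)
    show "bij_betw (\<lambda>(p, q). F (T p) (T q)) (carrier (sym_group (CARD('n) - 1) \<times>\<times> sym_group (CARD('n) - 1)))
      (carrier (cstar_aut\<lparr>carrier := twists\<rparr>))"
    proof -
      let ?P = "{p. p permutes ?A}" and ?R = "{p. p permutes ?B}"
      have "bij_betw (map_prod T T) (?P \<times> ?P) (?R \<times> ?R)"
        by (rule bij_betw_map_prod[OF T T])
      moreover have "bij_betw (\<lambda>(p, q). F p q) (?R \<times> ?R) twists"
        unfolding bij_betw_def
      proof
        show "inj_on (\<lambda>(p, q). F p q) (?R \<times> ?R)"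
        proof (rule inj_onI, clarify)
          fix p q p' q'
          assume "p permutes ?B" "q permutes ?B" "p' permutes ?B" "q' permutes ?B" "F p q = F p' q'"
          then show "p = p' \<and> q = q'" by (intro F_inj)
        qed
        show "(\<lambda>(p, q). F p q) ` (?R \<times> ?R) = twists"
          by (auto simp: twists_def image_iff)
      qed
      ultimately have "bij_betw ((\<lambda>(p, q). F p q) \<circ> map_prod T T) (?P \<times> ?P) twists"
        by (rule bij_betw_trans)
      moreover have "(\<lambda>(p, q). F p q) \<circ> map_prod T T = (\<lambda>(p, q). F (T p) (T q))"
        by auto
      ultimately show ?thesis by (simp add: DirProd_def sym_group_def)
    qed
  qed
  then show ?thesis
    by (rule group.iso_sym[OF group_DirProd_sym_group is_isoI])
qed

lemma kernel_out_proj: "kernel (cstar_aut\<lparr>carrier := twists\<rparr>) cstar_out out_proj = {id}"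
proof -
  \<comment> \<open>Written this way, lying in the kernel says that \<open>F p q\<close> and
    \<open>F id id\<close> have the same class, which yields an intertwiner between them.\<close>
  have one: "\<one>\<^bsub>cstar_out\<^esub> = out_proj (F id id)"
    by (simp add: cstar_out_def FactGroup_def F_id out_proj_id)
  have "F p q = F id id" if "p permutes (UNIV - {i})" "q permutes (UNIV - {i})"
    and eq: "out_proj (F p q) = out_proj (F id id)" for p q
  proof -
    obtain w where "w \<noteq> 0" "\<And>x. F p q x * w = w * F id id x"
      using out_proj_eqD[OF eq] by blast
    then show ?thesis
      using intertwiner_imp_eq[of p id q id w] that permutes_id by blast
  qed
  then have "kernel (cstar_aut\<lparr>carrier := twists\<rparr>) cstar_out out_proj = {F id id}"
    unfolding kernel_def one by (auto simp: twists_def intro: permutes_id)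
  then show ?thesis by (simp add: F_id)
qed

end

section \<open>The groups \<open>Q S i\<close> and \<open>Q' S i\<close> and the distinctness of
  their outer images\<close>

context cuntz_generators
begin

lemma twisted_action_row: "twisted_action S i (\<lambda>p q. perm_endo S (row_perm i p q))"
  by unfold_locales
    (simp_all add: hom_perm_endo bij_row_perm permutes_bij row_comp row_id row_tracks_single row_tracks_pair)

lemma twisted_action_col: "twisted_action S i (\<lambda>p q. perm_endo S (col_perm i p q))"
  by unfold_locales
    (simp_all add: hom_perm_endo bij_col_perm permutes_bij col_comp col_id col_tracks_single col_tracks_pair)

lemma Q_eq: "Q S i = {perm_endo S (row_perm i p q) | p q. p permutes (UNIV - {i}) \<and> q permutes (UNIV - {i})}"
proof -
  interpret twisted_action S i "\<lambda>p q. perm_endo S (row_perm i p q)" by (rule twisted_action_row)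
  show ?thesis
    using generate_eq_twists unfolding twists_def
    by (simp add: Q_def R_perms_eq R_check_perms_eq image_Un image_image)
qed

lemma Q'_eq: "Q' S i = {perm_endo S (col_perm i p q) | p q. p permutes (UNIV - {i}) \<and> q permutes (UNIV - {i})}"
proof -
  interpret twisted_action S i "\<lambda>p q. perm_endo S (col_perm i p q)" by (rule twisted_action_col)
  show ?thesis
    using generate_eq_twists unfolding twists_def
    by (simp add: Q'_def C_perms_eq C_check_perms_eq image_Un image_image)
qed

lemma Q_properties:
  "subgroup (Q S i) cstar_aut" "Q S i \<subseteq> perm2_auts S"
  "cstar_aut\<lparr>carrier := Q S i\<rparr> \<cong> sym_group (CARD('n) - 1) \<times>\<times> sym_group (CARD('n) - 1)"
  "kernel (cstar_aut\<lparr>carrier := Q S i\<rparr>) cstar_out out_proj = {id}"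
proof -
  interpret twisted_action S i "\<lambda>p q. perm_endo S (row_perm i p q)" by (rule twisted_action_row)
  have Q: "Q S i = twists" by (simp add: Q_eq twists_def)
  show "subgroup (Q S i) cstar_aut"
    "cstar_aut\<lparr>carrier := Q S i\<rparr> \<cong> sym_group (CARD('n) - 1) \<times>\<times> sym_group (CARD('n) - 1)"
    "kernel (cstar_aut\<lparr>carrier := Q S i\<rparr>) cstar_out out_proj = {id}"
    unfolding Q by (rule subgroup_twists twists_iso kernel_out_proj)+
  have "row_perm i p q permutes UNIV" if "p permutes (UNIV - {i})" "q permutes (UNIV - {i})" for p q
    using that by (intro bij_imp_permutes bij_row_perm) (auto dest: permutes_bij)
  then show "Q S i \<subseteq> perm2_auts S"
    unfolding Q_eq perm2_auts_def using F_in_carrier by blast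
qed

lemma Q'_properties:
  "subgroup (Q' S i) cstar_aut" "Q' S i \<subseteq> perm2_auts S"
  "cstar_aut\<lparr>carrier := Q' S i\<rparr> \<cong> sym_group (CARD('n) - 1) \<times>\<times> sym_group (CARD('n) - 1)"
  "kernel (cstar_aut\<lparr>carrier := Q' S i\<rparr>) cstar_out out_proj = {id}"
proof -
  interpret twisted_action S i "\<lambda>p q. perm_endo S (col_perm i p q)" by (rule twisted_action_col)
  have Q': "Q' S i = twists" by (simp add: Q'_eq twists_def)
  show "subgroup (Q' S i) cstar_aut"
    "cstar_aut\<lparr>carrier := Q' S i\<rparr> \<cong> sym_group (CARD('n) - 1) \<times>\<times> sym_group (CARD('n) - 1)"
    "kernel (cstar_aut\<lparr>carrier := Q' S i\<rparr>) cstar_out out_proj = {id}"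
    unfolding Q' by (rule subgroup_twists twists_iso kernel_out_proj)+
  have "col_perm i p q permutes UNIV" if "p permutes (UNIV - {i})" "q permutes (UNIV - {i})" for p q
    using that by (intro bij_imp_permutes bij_col_perm) (auto dest: permutes_bij)
  then show "Q' S i \<subseteq> perm2_auts S"
    unfolding Q'_eq perm2_auts_def using F_in_carrier by blast
qed

text \<open>A member of \<open>B\<close> with the class of \<phi> would give an intertwiner, but
  \<phi> sends \<open>jjj...\<close> to \<open>kkk...\<close> while every member of \<open>B\<close>
  preserves \<open>jjj...\<close>.\<close>

lemma out_proj_image_neq:
  assumes \<phi>: "\<phi> \<in> A" "unital_star_hom \<phi>" "tracks \<phi> [j] [k]" and "j \<noteq> k"
    and B: "\<And>\<psi>. \<psi> \<in> B \<Longrightarrow> tracks \<psi> [j] [j]"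
  shows "out_proj ` A \<noteq> out_proj ` B"
proof
  assume eq: "out_proj ` A = out_proj ` B"
  have "out_proj \<phi> \<in> out_proj ` A" using \<phi>(1) by (rule imageI)
  then obtain \<psi> where \<psi>: "\<psi> \<in> B" "out_proj \<phi> = out_proj \<psi>"
    unfolding eq by blast
  obtain w where w: "w \<noteq> 0" "\<And>x. \<phi> x * w = w * \<psi> x" using out_proj_eqD[OF \<psi>(2)] by blast
  from intertwiner_tracks_subset[OF \<phi>(2) w \<phi>(3) B[OF \<psi>(1)]] \<open>j \<noteq> k\<close> show False by simp
qed

lemma third_index:
  fixes i j :: "'b::finite"
  assumes "CARD('b) \<ge> 3"
  obtains k where "k \<noteq> i" "k \<noteq> j"
proof -
  have "card (UNIV - {i, j}) \<noteq> 0"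
    using assms by (simp add: card_Diff_subset card_insert_if)
  then obtain k where "k \<in> UNIV - {i, j}" by (metis card.empty all_not_in_conv)
  with that show ?thesis by blast
qed

lemma tracks_Q_center: "\<psi> \<in> Q S j \<Longrightarrow> tracks \<psi> [j] [j]"
  by (auto simp: Q_eq intro: row_tracks_center)

lemma tracks_Q'_center: "\<psi> \<in> Q' S j \<Longrightarrow> tracks \<psi> [j] [j]"
  by (auto simp: Q'_eq intro: col_tracks_center)

text \<open>The third index makes the transposition of \<open>j\<close> and \<open>k\<close> fix
  \<open>i\<close>; taken as the \<open>q\<close> component it moves \<open>jjj...\<close> to
  \<open>kkk...\<close>.\<close>

lemma Q_moves_other_center:
  assumes "CARD('n) \<ge> 3" "i \<noteq> j"
  obtains \<phi> k where "\<phi> \<in> Q S i" "unital_star_hom \<phi>" "tracks \<phi> [j] [k]" "j \<noteq> k"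
proof -
  obtain k where k: "k \<noteq> i" "k \<noteq> j" using third_index[OF assms(1)] .
  have t: "Transposition.transpose j k permutes (UNIV - {i})"
    using k assms by (intro permutes_swap_id) auto
  show ?thesis
  proof (rule that)
    show "perm_endo S (row_perm i id (Transposition.transpose j k)) \<in> Q S i"
      unfolding Q_eq using t permutes_id by blast
    show "unital_star_hom (perm_endo S (row_perm i id (Transposition.transpose j k)))"
      by (intro hom_perm_endo bij_row_perm bij_id permutes_bij[OF t])
    show "tracks (perm_endo S (row_perm i id (Transposition.transpose j k))) [j] [k]"
      using row_tracks_single[OF permutes_id t, of j] assms(2) by simp
  qed (use k in simp)
qed

lemma Q'_moves_other_center:
  assumes "CARD('n) \<ge> 3" "i \<noteq> j"
  obtains \<phi> k where "\<phi> \<in> Q' S i" "unital_star_hom \<phi>" "tracks \<phi> [j] [k]" "j \<noteq> k"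
proof -
  obtain k where k: "k \<noteq> i" "k \<noteq> j" using third_index[OF assms(1)] .
  have t: "Transposition.transpose j k permutes (UNIV - {i})"
    using k assms by (intro permutes_swap_id) auto
  show ?thesis
  proof (rule that)
    show "perm_endo S (col_perm i id (Transposition.transpose j k)) \<in> Q' S i"
      unfolding Q'_eq using t permutes_id by blast
    show "unital_star_hom (perm_endo S (col_perm i id (Transposition.transpose j k)))"
      by (intro hom_perm_endo bij_col_perm bij_id permutes_bij[OF t])
    show "tracks (perm_endo S (col_perm i id (Transposition.transpose j k))) [j] [k]"
      using col_tracks_single[OF permutes_id t, of j] assms(2) by simp
  qed (use k in simp)
qed

text \<open>With \<open>p = (a b)\<close>, the words \<open>aaa\<dots>\<close> and \<open>ibib\<dots>\<close> force a counterpart in \<open>Q' S i\<close> of the element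
  with data \<open>(p, id)\<close> to have data \<open>(p, id)\<close> too, but the former sends \<open>iabiab\<dots>\<close> to \<open>ibbibb\<dots>\<close>, the latter
  to \<open>iaaiaa\<dots>\<close>.\<close>

lemma out_proj_Q_neq_Q'_same:
  assumes card: "CARD('n) \<ge> 3"
  shows "out_proj ` Q S i \<noteq> out_proj ` Q' S i"
proof
  assume eq: "out_proj ` Q S i = out_proj ` Q' S i"
  obtain a where a: "a \<noteq> i" using third_index[OF card, of i i] by blast
  obtain b where b: "b \<noteq> i" "b \<noteq> a" using third_index[OF card] .
  define p where "p = Transposition.transpose a b"
  have p: "p permutes (UNIV - {i})"
    unfolding p_def using a b by (intro permutes_swap_id) auto
  define \<phi> where "\<phi> = perm_endo S (row_perm i p id)"
  have \<phi>: "unital_star_hom \<phi>"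
    unfolding \<phi>_def by (intro hom_perm_endo bij_row_perm bij_id permutes_bij[OF p])
  have "\<phi> \<in> Q S i"
    unfolding \<phi>_def Q_eq using p permutes_id by blast
  from imageI[OF this, of out_proj]
  obtain \<psi> where "\<psi> \<in> Q' S i" "out_proj \<phi> = out_proj \<psi>"
    unfolding eq by blast
  then obtain p' q' where p': "p' permutes (UNIV - {i})" and q': "q' permutes (UNIV - {i})"
    and \<psi>: "out_proj \<phi> = out_proj (perm_endo S (col_perm i p' q'))"
    by (auto simp: Q'_eq)
  obtain w where w: "w \<noteq> 0" "\<And>x. \<phi> x * w = w * perm_endo S (col_perm i p' q') x"
    using out_proj_eqD[OF \<psi>] by blast
  note sub = intertwiner_tracks_subset[OF \<phi> w]
  have "{q' a} \<subseteq> {a}"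
    using sub[OF row_tracks_single[OF p permutes_id, of a, folded \<phi>_def] col_tracks_single[OF p' q']] a
    by simp
  moreover have "{i, p' b} \<subseteq> {i, a}"
    using sub[OF row_tracks_pair[OF p permutes_id, of b, folded \<phi>_def] col_tracks_pair[OF p' q']] b
    by (simp add: p_def)
  moreover have "{i, q' a, p' b} \<subseteq> {i, b}"
    using sub[OF row_tracks_triple[OF p permutes_id, of a b, folded \<phi>_def]
        col_tracks_triple[OF p' q']] a b
    by (simp add: p_def)
  \<comment> \<open>The first inclusion gives \<open>q' a = a\<close>, which the third one places in
    \<open>{i, b}\<close>.\<close>
  ultimately show False using a b by auto
qed

end

theorem theorem5p10:
  fixes S :: "'n::finite \<Rightarrow> 'a::cstar_algebra"
  assumes "is_cuntz_algebra S" and "CARD('n) \<ge> 3"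
  shows "(\<forall>i.
        subgroup (Q S i) cstar_aut \<and>
        Q S i \<subseteq> perm2_auts S \<and>
        cstar_aut\<lparr>carrier := Q S i\<rparr> \<cong> sym_group (CARD('n) - 1) \<times>\<times> sym_group (CARD('n) - 1) \<and>
        kernel (cstar_aut\<lparr>carrier := Q S i\<rparr>) cstar_out out_proj = {id}) \<and>
    (\<forall>i.
        subgroup (Q' S i) cstar_aut \<and>
        Q' S i \<subseteq> perm2_auts S \<and>
        cstar_aut\<lparr>carrier := Q' S i\<rparr> \<cong> sym_group (CARD('n) - 1) \<times>\<times> sym_group (CARD('n) - 1) \<and>
        kernel (cstar_aut\<lparr>carrier := Q' S i\<rparr>) cstar_out out_proj = {id}) \<and>
    inj (\<lambda>i. out_proj ` Q S i) \<and>
    inj (\<lambda>i. out_proj ` Q' S i) \<and>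
    (\<forall>i j. out_proj ` Q S i \<noteq> out_proj ` Q' S j)"
proof -
  interpret cuntz_generators S by unfold_locales (rule assms(1))
  \<comment> \<open>Groups with different indices are separated by the constant word
    \<open>jjj...\<close>, which the second group preserves and the first does not. Rows and columns
    with the same index are left to the triples.\<close>
  have "out_proj ` Q S i \<noteq> out_proj ` Q S j" "out_proj ` Q S i \<noteq> out_proj ` Q' S j" if "i \<noteq> j" for i j
    by (rule Q_moves_other_center[OF assms(2) that],
        erule (3) out_proj_image_neq, erule tracks_Q_center tracks_Q'_center)+
  note row = this
  have col: "out_proj ` Q' S i \<noteq> out_proj ` Q' S j" if "i \<noteq> j" for i j
    by (rule Q'_moves_other_center[OF assms(2) that],
        erule (3) out_proj_image_neq, erule tracks_Q'_center)
  have "inj (\<lambda>i. out_proj ` Q S i)" "inj (\<lambda>i. out_proj ` Q' S i)"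
    using row(1) col by (meson injI)+
  moreover have "out_proj ` Q S i \<noteq> out_proj ` Q' S j" for i j
    using row(2) out_proj_Q_neq_Q'_same[OF assms(2)] by (cases "i = j") auto
  ultimately show ?thesis
    by (intro conjI allI Q_properties Q'_properties)
qed

end
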